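(* Let $n,m\in\mathbb N_0$, let $q\in\mathbb C$ with $0<|q|<1$, let $\alpha,a\in\mathbb C\setminus\{0\}$, and define, for $\beta\in\mathbb C\setminus\{0\}$, $$\Psi_{m,n}(\beta;a|q):=\sum_{k=-\infty}^\infty(1+q^{2k}\beta^2)\,\mathsf H_n[q^k\beta;a|q]\,\mathsf H_m[q^k\beta;a|q]\,\Big(-q^{k+1}\beta a,\frac{q^{1-k}a}{\beta};q\Big)_\infty q^{2k^2-k}\beta^{4k}.$$ Then $$\Psi_{m,n}(\alpha;a|q)=\Big(q,-\alpha^2,-\frac q{\alpha^2};q\Big)_\infty\frac{q^{-\binom n2}(q;q)_n}{q^n}\,\delta_{m,n},$$ and $$\int_{-\infty}^\infty(1+q^{2x}\alpha^2)\,\mathsf H_n[q^x\alpha;a|q]\,\mathsf H_m[q^x\alpha;a|q]\,\Big(-q^{x+1}\alpha a,\frac{q^{1-x}a}{\alpha};q\Big)_\infty q^{2x^2-x}\alpha^{4x}\,dx$$ $$=\int_0^1\Psi_{m,n}(q^x\alpha;a|q)\,q^{2x^2-x}\alpha^{4x}\,dx$$ $$=(q;q)_\infty\frac{q^{-\binom n2}(q;q)_n\,\delta_{m,n}}{q^n}\int_0^1\Big(-q^{2x}\alpha^2,-\frac{q^{1-2x}}{\alpha^2};q\Big)_\infty q^{2x^2-x}\alpha^{4x}\,dx$$ $$=\frac{\sqrt{2\pi}\,\alpha\,\exp\left(\frac{2(\log\alpha)^2}{\log q^{-1}}\right)}{q^{1/8}\sqrt{\log q^{-1}}}\,\frac{q^{-\binom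 n2}(q;q)_n}{q^n}\,\delta_{m,n}.$$
   Context: Notation: $\mathbb N_0=\{0,1,2,\dots\}$. For $n\in\mathbb N_0$, $(y;q)_n=\prod_{j=0}^{n-1}(1-yq^j)$, $(y;q)_\infty=\prod_{j\ge0}(1-yq^j)$, and $(y_1,\dots,y_r;q)_k=\prod_i(y_i;q)_k$, also for $k=\infty$. $\delta_{m,n}$ is the Kronecker delta. Powers are $q^s=\exp(s\log q)$, $\alpha^{s}=\exp(s\log\alpha)$ with principal logarithms, $\log q^{-1}=-\log q$ (which has positive real part), and $\sqrt{\log q^{-1}}$ is the principal square root. The continuous big $q^{-1}$-Hermite polynomials are polynomials of degree $n$ in $x=\frac12(z-z^{-1})$, defined by $\mathsf H_n[z;a|q]=i^{-n}H_n[iz;ia|q^{-1}]$, where $H_n$ is the continuous big $q$-Hermite polynomial in standard normalization, written as a function of $w$ with argument $\frac12(w+w^{-1})$. Explicitly, $$\mathsf H_n[z;a|q]=\Big(-\frac1a\Big)^n\sum_{k=0}^n\frac{(q^{-n},\frac za,-\frac1{az};q)_k}{(q;q)_k}\,q^{-2\binom k2}\,(-q^na^2)^k.$$ *)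

theory Defs
  imports "HOL-Analysis.Analysis"
begin

text \<open>The lists of parameters stand for the usual multi-parameter notation
  \<open>(y\<^sub>1, \<dots>, y\<^sub>r; q)\<^sub>k\<close>.\<close>

definition qpoch :: "complex list \<Rightarrow> complex \<Rightarrow> nat \<Rightarrow> complex" where
  "qpoch ys q n = (\<Prod>y\<leftarrow>ys. \<Prod>j<n. (1 - y * q ^ j))"

definition qpoch_inf :: "complex list \<Rightarrow> complex \<Rightarrow> complex" where
  "qpoch_inf ys q = (\<Prod>y\<leftarrow>ys. \<Prod>j. (1 - y * q ^ j))"

lemma convergent_prod_qpoch_inf:
  fixes y q :: complex
  assumes "norm q < 1"
  shows "convergent_prod (\<lambda>j. 1 - y * q ^ j)"
proof -
  have "summable (\<lambda>j. norm y * norm q ^ j)"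
    using assms by (intro summable_mult summable_geometric) auto
  then have "summable (\<lambda>j. norm (- (y * q ^ j)))"
    by (simp add: norm_mult norm_power)
  then have "abs_convergent_prod (\<lambda>j. 1 + - (y * q ^ j))"
    by (intro summable_imp_abs_convergent_prod) simp
  then show ?thesis
    by (simp add: abs_convergent_prod_imp_convergent_prod)
qed

text \<open>The continuous big \<open>q\<close>-Hermite polynomial
  \<open>H\<^sub>n(x; a | q) = a\<^sup>-\<^sup>n \<^sub>3\<phi>\<^sub>2(q\<^sup>-\<^sup>n, a w, a/w; 0, 0; q, q)\<close> in its standard normalization,
  as a function of \<open>w\<close>, where \<open>x = (w + 1/w)/2\<close>.
  The base \<open>q\<close> may have modulus greater than \<open>1\<close>.\<close>

definition big_qHermite :: "nat \<Rightarrow> complex \<Rightarrow> complex \<Rightarrow> complex \<Rightarrow> complex" where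
  "big_qHermite n w a q =
     (1 / a) ^ n * (\<Sum>k=0..n. qpoch [q powi (- int n), a * w, a / w] q k / qpoch [q] q k * q ^ k)"

definition big_qinv_Hermite :: "nat \<Rightarrow> complex \<Rightarrow> complex \<Rightarrow> complex \<Rightarrow> complex" where
  "big_qinv_Hermite n z a q =
     \<i> powi (- int n) * big_qHermite n (\<i> * z) (\<i> * a) (inverse q)"

lemma qpoch_inverse_base:
  assumes "q \<noteq> 0" "y \<noteq> 0"
  shows "qpoch [y] (inverse q) k = qpoch [inverse y] q k * (- y) ^ k * q powi (- int (k choose 2))"
proof (induction k)
  case 0
  then show ?case by (simp add: qpoch_def numeral_2_eq_2)
next
  case (Suc k)
  have c: "q powi (- int (Suc k choose 2)) = q powi (- int (k choose 2)) * inverse (q ^ k)"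
  proof -
    have "Suc k choose 2 = k + (k choose 2)"
      by (simp add: numeral_2_eq_2)
    then show ?thesis
      by (simp only: power_int_minus power_int_of_nat power_add inverse_mult_distrib mult.commute)
  qed
  have s: "1 - y * inverse q ^ k = (1 - inverse y * q ^ k) * (- y) * inverse (q ^ k)"
    using assms by (simp add: field_simps)
  have "qpoch [y] (inverse q) (Suc k) = qpoch [y] (inverse q) k * (1 - y * inverse q ^ k)"
    by (simp add: qpoch_def)
  also have "\<dots> = qpoch [inverse y] q k * (1 - inverse y * q ^ k) * ((- y) ^ k * (- y))
      * (q powi (- int (k choose 2)) * inverse (q ^ k))"
    unfolding Suc.IH s by (simp add: mult_ac)
  also have "\<dots> = qpoch [inverse y] q (Suc k) * (- y) ^ Suc k * q powi (- int (Suc k choose 2))"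
    unfolding c by (simp add: qpoch_def)
  finally show ?case .
qed

lemma big_qinv_Hermite_explicit:
  assumes "q \<noteq> 0" "a \<noteq> 0" "z \<noteq> 0"
  shows "big_qinv_Hermite n z a q =
     (- (1 / a)) ^ n *
     (\<Sum>k=0..n. qpoch [q powi (- int n), z / a, - (1 / (a * z))] q k / qpoch [q] q k
        * q powi (- 2 * int (k choose 2)) * (- (q ^ n) * a\<^sup>2) ^ k)"
proof -
  have split: "qpoch [u, v, w] p k = qpoch [u] p k * qpoch [v] p k * qpoch [w] p k" for u v w p k
    by (simp add: qpoch_def)
  have ii: "\<i> * a * (\<i> * z) = - (a * z)"
  proof -
    have "\<i> * a * (\<i> * z) = (\<i> * \<i>) * (a * z)"
      by (simp only: mult_ac)
    then show ?thesis by simp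
  qed
  have di: "\<i> * a / (\<i> * z) = a / z"
    by simp
  have pre: "\<i> powi (- int n) * (1 / (\<i> * a)) ^ n = (- (1 / a)) ^ n"
  proof -
    have "\<i> powi (- int n) * (1 / (\<i> * a)) ^ n = (inverse \<i> * (1 / (\<i> * a))) ^ n"
      by (simp only: power_int_minus power_int_of_nat power_mult_distrib power_inverse)
    also have "inverse \<i> * (1 / (\<i> * a)) = - (1 / a)"
      by (simp add: field_simps)
    finally show ?thesis .
  qed
  have qn: "inverse q powi (- int n) = q ^ n"
    using assms by (simp add: power_int_minus power_inverse)
  have summand: "qpoch [inverse q powi (- int n), \<i> * a * (\<i> * z), \<i> * a / (\<i> * z)] (inverse q) k
        / qpoch [inverse q] (inverse q) k * inverse q ^ k
      = qpoch [q powi (- int n), z / a, - (1 / (a * z))] q k / qpoch [q] q k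
        * q powi (- 2 * int (k choose 2)) * (- (q ^ n) * a\<^sup>2) ^ k" for k
  proof -
    define B where "B = q powi (- int (k choose 2))"
    have B0: "B \<noteq> 0" using assms by (simp add: B_def)
    have BB: "q powi (- 2 * int (k choose 2)) = B * B"
      using assms unfolding B_def by (simp flip: power_int_add)
    have 1: "qpoch [q ^ n] (inverse q) k = qpoch [q powi (- int n)] q k * (- (q ^ n)) ^ k * B"
      using qpoch_inverse_base[of q "q ^ n" k] assms by (simp add: B_def power_int_minus)
    have 2: "qpoch [- (a * z)] (inverse q) k = qpoch [- (1 / (a * z))] q k * (a * z) ^ k * B"
      using qpoch_inverse_base[of q "- (a * z)" k] assms by (simp add: B_def divide_inverse)
    have 3: "qpoch [a / z] (inverse q) k = qpoch [z / a] q k * (- (a / z)) ^ k * B"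
      using qpoch_inverse_base[of q "a / z" k] assms by (simp add: B_def)
    have 4: "qpoch [inverse q] (inverse q) k = qpoch [q] q k * (- inverse q) ^ k * B"
      using qpoch_inverse_base[of q "inverse q" k] assms by (simp add: B_def)
    have p: "(- (q ^ n)) ^ k * (a * z) ^ k * (- (a / z)) ^ k * inverse q ^ k
        = (- inverse q) ^ k * (- (q ^ n) * a\<^sup>2) ^ k"
      unfolding power_mult_distrib[symmetric]
      using assms by (intro arg_cong[where f = "\<lambda>x. x ^ k"]) (simp add: field_simps power2_eq_square)
    have nz: "(- inverse q) ^ k \<noteq> 0" using assms by simp
    define N where "N = qpoch [q powi (- int n)] q k * qpoch [z / a] q k * qpoch [- (1 / (a * z))] q k"
    define Q where "Q = qpoch [q] q k"
    have "qpoch [q ^ n, - (a * z), a / z] (inverse q) k / qpoch [inverse q] (inverse q) k * inverse q ^ k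
       = N * B * B * B * ((- (q ^ n)) ^ k * (a * z) ^ k * (- (a / z)) ^ k * inverse q ^ k)
          / (Q * (- inverse q) ^ k * B)"
      unfolding split[of "q ^ n"] 1 2 3 4 N_def Q_def by (simp add: mult_ac)
    also have "\<dots> = N / Q * (B * B) * (- (q ^ n) * a\<^sup>2) ^ k"
      unfolding p using nz B0 by (simp add: divide_simps)
    finally show ?thesis
      unfolding ii di qn BB N_def Q_def split[of "q powi (- int n)"] .
  qed
  have "big_qinv_Hermite n z a q = (\<i> powi (- int n) * (1 / (\<i> * a)) ^ n) *
      (\<Sum>k=0..n. qpoch [inverse q powi (- int n), \<i> * a * (\<i> * z), \<i> * a / (\<i> * z)] (inverse q) k
        / qpoch [inverse q] (inverse q) k * inverse q ^ k)"
    by (simp add: big_qinv_Hermite_def big_qHermite_def mult.assoc)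
  then show ?thesis
    unfolding pre summand .
qed

definition Psi_term :: "nat \<Rightarrow> nat \<Rightarrow> complex \<Rightarrow> complex \<Rightarrow> complex \<Rightarrow> int \<Rightarrow> complex" where
  "Psi_term m n \<beta> a q k =
     (1 + q powi (2 * k) * \<beta>\<^sup>2)
     * big_qinv_Hermite n (q powi k * \<beta>) a q * big_qinv_Hermite m (q powi k * \<beta>) a q
     * qpoch_inf [- (q powi (k + 1)) * \<beta> * a, q powi (1 - k) * a / \<beta>] q
     * q powi (2 * k\<^sup>2 - k) * \<beta> powi (4 * k)"

definition Psi :: "nat \<Rightarrow> nat \<Rightarrow> complex \<Rightarrow> complex \<Rightarrow> complex \<Rightarrow> complex" where
  "Psi m n \<beta> a q = (\<Sum>\<^sub>\<infinity>k\<in>UNIV. Psi_term m n \<beta> a q k)"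

end

theory Submission
  imports Defs "HOL-Probability.Characteristic_Functions" "HOL-Complex_Analysis.Conformal_Mappings"
begin

text \<open>
  Write \<open>W(a; z) = (-q a z, q a/z; q)\<^sub>\<infinity>\<close>, \<open>y = z - 1/z\<close> and, for a function \<open>f\<close>,
  let \<open>S\<^sub>a(f)\<close> be the sum of \<open>(1 + z\<^sup>2) f(z) W(a; z)\<close> over the points \<open>z = q\<^sup>k \<beta>\<close>,
  \<open>k \<in> \<int>\<close>, with the Gaussian weights of the theorem. Everything rests on two properties of \<open>W\<close>.

  Firstly, \<open>(1 + z\<^sup>2) (y - a) W(a; z)\<close> times the Gaussian weight is a difference of consecutive
  terms of a summable sequence, so \<open>S\<^sub>a(y - a) = 0\<close> (\<open>bisum_telescope\<close>). Secondly,
  \<open>W(a/q; z) = (1 + a y - a\<^sup>2) W(a; z)\<close> (\<open>weight_divide_q\<close>). Together they give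
  \<open>S\<^bsub>a/q\<^esub>(1) = S\<^sub>a(1)\<close>, and letting \<open>a q\<^sup>N \<rightarrow> 0\<close> shows that \<open>S\<^sub>a(1)\<close> does not depend
  on \<open>a\<close> (\<open>bisum_independent\<close>). The value at \<open>a = 0\<close> is a theta series, which
  Jacobi's triple product identity evaluates (\<open>triple_product\<close>, \<open>bisum_0_eq_theta\<close>).

  The second property also reads \<open>a S\<^sub>a(y f) = S\<^bsub>a/q\<^esub>(f) - (1 - a\<^sup>2) S\<^sub>a(f)\<close>. Hence, by induction,
  \<open>S\<^sub>a(p(y))\<close> is, up to the constant \<open>S\<^sub>0(1)\<close>, a polynomial in \<open>a\<close> of at most the
  degree of \<open>p\<close> and with the same leading coefficient (\<open>bisum_poly\<close>). Iterating it turns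
  \<open>H\<^sub>n W(a; z)\<close> into a linear combination of \<open>W(a q\<^bsup>-k\<^esup>; z)\<close>, \<open>k \<le> n\<close>, with
  \<open>q\<close>-binomial coefficients (\<open>hermite_weight\<close>). So \<open>S\<^sub>a(H\<^sub>m H\<^sub>n)\<close> is an \<open>n\<close>-th \<open>q\<close>-difference of a
  polynomial of degree \<open>m\<close> in \<open>a\<close>; by the \<open>q\<close>-binomial theorem such a difference annihilates
  degrees below \<open>n\<close> and multiplies \<open>a\<^sup>n\<close> by an explicit factor
  (\<open>bisum_hermite_poly\<close>, \<open>Psi_eq\<close>).

  For the integrals, translating \<open>x\<close> by an integer \<open>k\<close> replaces \<open>q\<^sup>x \<alpha>\<close> by
  \<open>q\<^sup>k q\<^sup>x \<alpha>\<close>, so cutting the line into unit intervals turns the integral over the line into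
  the integral of the bilateral sum over \<open>[0, 1]\<close> (\<open>integral_unfold\<close>,
  \<open>integral_summand\<close>). Reading the same identity backwards with \<open>a = 0\<close> and \<open>f = 1\<close> reduces
  the theta integral to \<open>\<integral> (g(x) + g(x + 1/2)) dx = 2 \<integral> g(x) dx\<close>
  with \<open>g\<close> a Gaussian (\<open>integral_theta\<close>). Since \<open>log q\<close> may be complex, the Gaussian
  integral is needed for complex parameters; it follows from the characteristic function of the
  normal distribution by analytic continuation (\<open>integral_gaussian\<close>).
\<close>

section \<open>Shifted factorials\<close>

lemma qpoch_inf_Cons: "qpoch_inf (y # ys) q = qpoch_inf [y] q * qpoch_inf ys q"
  by (simp add: qpoch_inf_def)

lemma qpoch_Cons: "qpoch (y # ys) q n = qpoch [y] q n * qpoch ys q n"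
  by (simp add: qpoch_def)

lemma qpoch_0 [simp]: "qpoch ys q 0 = 1"
  by (induction ys) (simp_all add: qpoch_def)

lemma qpoch_Suc: "qpoch [y] q (Suc n) = qpoch [y] q n * (1 - y * q ^ n)"
  by (simp add: qpoch_def)

lemma qpoch_Suc_shift: "qpoch [y] q (Suc n) = (1 - y) * qpoch [q * y] q n"
  unfolding qpoch_def by (simp add: prod.lessThan_Suc_shift mult_ac del: prod.lessThan_Suc)

locale nome =
  fixes q :: complex
  assumes norm_q_pos: "0 < norm q" and norm_q_less_1: "norm q < 1"
begin

lemma q_nonzero [simp]: "q \<noteq> 0"
  using norm_q_pos by auto

lemma qpoch_LIMSEQ: "qpoch [y] q \<longlonglongrightarrow> qpoch_inf [y] q"
  using has_prod_imp_tendsto'[OF convergent_prod_has_prod[OF convergent_prod_qpoch_inf[OF norm_q_less_1, of y]]]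
  by (simp add: qpoch_def[abs_def] qpoch_inf_def)

lemma qpoch_inf_shift: "qpoch_inf [y] q = (1 - y) * qpoch_inf [q * y] q"
proof -
  have "(\<lambda>n. qpoch [y] q (Suc n)) \<longlonglongrightarrow> qpoch_inf [y] q"
    using qpoch_LIMSEQ by (rule LIMSEQ_Suc)
  moreover have "(\<lambda>n. qpoch [y] q (Suc n)) \<longlonglongrightarrow> (1 - y) * qpoch_inf [q * y] q"
    unfolding qpoch_Suc_shift by (intro tendsto_intros qpoch_LIMSEQ)
  ultimately show ?thesis by (rule LIMSEQ_unique)
qed

lemma qpoch_inf_nonzero: "norm y < 1 \<Longrightarrow> qpoch_inf [y] q \<noteq> 0"
proof -
  assume y: "norm y < 1"
  have "1 - y * q ^ j \<noteq> 0" for j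
  proof
    assume "1 - y * q ^ j = 0"
    then have "norm (y * q ^ j) = 1" by (metis eq_iff_diff_eq_0 norm_one)
    moreover have "norm y * norm q ^ j \<le> norm y * 1"
      by (intro mult_left_mono power_le_one) (use norm_q_less_1 in auto)
    ultimately show False using y by (simp add: norm_mult norm_power)
  qed
  then show ?thesis
    using prodinf_nonzero[OF convergent_prod_qpoch_inf[OF norm_q_less_1, of y]]
    by (simp add: qpoch_inf_def)
qed

lemma qpoch_q_nonzero: "qpoch [q] q n \<noteq> 0"
proof -
  have "1 - q * q ^ j \<noteq> 0" for j
  proof
    assume "1 - q * q ^ j = 0"
    then have "norm (q ^ Suc j) = 1" by (metis eq_iff_diff_eq_0 norm_one power_Suc)
    moreover have "norm q ^ Suc j < 1"
      using norm_q_less_1 power_Suc_less_one[of "norm q" j] norm_q_pos by simp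
    ultimately show False by (simp only: norm_power)
  qed
  then show ?thesis by (simp add: qpoch_def)
qed

text \<open>Comparing the finite products with \<open>exp\<close> of a geometric series bounds
  \<open>(y; q)\<^sub>\<infinity>\<close> and shows that it tends to \<open>1\<close> as \<open>y \<rightarrow> 0\<close>.\<close>

lemma norm_qpoch_minus_1_le: "norm (qpoch [y] q n - 1) \<le> exp (norm y / (1 - norm q)) - 1"
proof -
  have "norm (qpoch [y] q n - 1) = norm ((\<Prod>j<n. 1 + - (y * q ^ j)) - 1)"
    by (simp add: qpoch_def)
  also have "\<dots> \<le> (\<Prod>j<n. 1 + norm (- (y * q ^ j))) - 1"
    by (rule norm_prod_minus1_le_prod_minus1)
  also have "(\<Prod>j<n. 1 + norm (- (y * q ^ j))) \<le> exp (\<Sum>j<n. norm (- (y * q ^ j)))"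
    by (rule prod_le_exp_sum) auto
  also have "(\<Sum>j<n. norm (- (y * q ^ j))) = norm y * (\<Sum>j<n. norm q ^ j)"
    by (simp add: norm_mult norm_power sum_distrib_left)
  also have "\<dots> \<le> norm y * (1 / (1 - norm q))"
  proof (rule mult_left_mono)
    show "(\<Sum>j<n. norm q ^ j) \<le> 1 / (1 - norm q)"
      using norm_q_less_1 by (simp add: sum_gp_strict divide_simps)
  qed simp
  finally show ?thesis by simp
qed

lemma norm_qpoch_inf_minus_1_le:
  "norm (qpoch_inf [y] q - 1) \<le> exp (norm y / (1 - norm q)) - 1"
proof (rule LIMSEQ_le_const2)
  show "(\<lambda>n. norm (qpoch [y] q n - 1)) \<longlonglongrightarrow> norm (qpoch_inf [y] q - 1)"
    by (intro tendsto_intros qpoch_LIMSEQ)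
qed (use norm_qpoch_minus_1_le in auto)

lemma norm_qpoch_le: "norm (qpoch [y] q n) \<le> exp (norm y / (1 - norm q))"
  using norm_qpoch_minus_1_le[of y n] norm_triangle_ineq[of "qpoch [y] q n - 1" 1] by simp

lemma norm_qpoch_inf_le: "norm (qpoch_inf [y] q) \<le> exp (norm y / (1 - norm q))"
  using norm_qpoch_inf_minus_1_le[of y] norm_triangle_ineq[of "qpoch_inf [y] q - 1" 1] by simp

lemma qpoch_inf_tendsto_1:
  assumes "(f \<longlongrightarrow> 0) F"
  shows "((\<lambda>x. qpoch_inf [f x] q) \<longlongrightarrow> 1) F"
proof -
  have "((\<lambda>x. exp (norm (f x) / (1 - norm q)) - 1) \<longlongrightarrow> exp (norm (0::complex) / (1 - norm q)) - 1) F"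
    by (intro tendsto_intros assms) (use norm_q_less_1 in auto)
  then have "((\<lambda>x. exp (norm (f x) / (1 - norm q)) - 1) \<longlongrightarrow> 0) F" by simp
  then have "((\<lambda>x. qpoch_inf [f x] q - 1) \<longlongrightarrow> 0) F"
    by (rule Lim_null_comparison[rotated]) (simp add: norm_qpoch_inf_minus_1_le)
  then show ?thesis using Lim_null by blast
qed

lemma borel_measurable_qpoch_inf [measurable (raw)]:
  assumes [measurable]: "f \<in> borel_measurable M"
  shows "(\<lambda>x. qpoch_inf [f x] q) \<in> borel_measurable M"
proof (rule borel_measurable_LIMSEQ_metric)
  show "(\<lambda>x. qpoch [f x] q n) \<in> borel_measurable M" for n
  proof -
    have "(\<lambda>x. \<Prod>j<n. 1 - f x * q ^ j) \<in> borel_measurable M" by measurable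
    then show ?thesis by (simp add: qpoch_def)
  qed
  show "(\<lambda>n. qpoch [f x] q n) \<longlonglongrightarrow> qpoch_inf [f x] q" for x
    by (rule qpoch_LIMSEQ)
qed

text \<open>Each of the \<open>n\<close> applications of the functional equation that bring an argument of size
  \<open>x |q|\<^sup>-\<^sup>n\<close> back to size \<open>x\<close> costs a factor \<open>1 + x |q|\<^sup>-\<^sup>j\<close>. The true order of growth is
  \<open>|q|\<close> to the power \<open>-n(n+1)/2\<close>; the exponent \<open>-n\<^sup>2\<close> is simpler and is enough
  against the weight \<open>|q|\<close> to the power \<open>2n\<^sup>2\<close>.\<close>

lemma norm_qpoch_inf_growth:
  assumes "norm y \<le> x / norm q ^ n"
  shows "norm (qpoch_inf [y] q) \<le> exp (x / (1 - norm q)) * (1 + x) ^ n / norm q ^ n\<^sup>2"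
  using assms
proof (induction n arbitrary: y)
  case 0
  then show ?case
    using norm_q_less_1
    by (intro order_trans[OF norm_qpoch_inf_le]) (simp add: divide_right_mono)
next
  case (Suc n)
  let ?r = "norm q"
  have x: "0 \<le> x"
    using order_trans[OF norm_ge_zero Suc.prems] norm_q_pos
    by (simp only: pos_le_divide_eq[OF zero_less_power[OF norm_q_pos]] mult_zero_left)
  have r: "0 < ?r ^ Suc n" "?r ^ Suc n \<le> 1"
    using norm_q_pos norm_q_less_1 by (auto intro!: power_le_one simp del: power_Suc)
  have "norm (q * y) \<le> x / ?r ^ n"
    using Suc.prems norm_q_pos by (simp add: norm_mult field_simps)
  then have IH: "norm (qpoch_inf [q * y] q) \<le> exp (x / (1 - ?r)) * (1 + x) ^ n / ?r ^ n\<^sup>2"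
    by (rule Suc.IH)
  have "norm (1 - y) \<le> 1 + norm y"
    using norm_triangle_ineq4[of 1 y] by simp
  also have "\<dots> \<le> 1 / ?r ^ Suc n + x / ?r ^ Suc n"
    using r Suc.prems by (intro add_mono) simp_all
  finally have 1: "norm (1 - y) \<le> (1 + x) / ?r ^ Suc n"
    by (simp add: add_divide_distrib)
  have "norm (qpoch_inf [y] q) = norm (1 - y) * norm (qpoch_inf [q * y] q)"
    by (subst qpoch_inf_shift) (simp add: norm_mult)
  also have "\<dots> \<le> ((1 + x) / ?r ^ Suc n) * (exp (x / (1 - ?r)) * (1 + x) ^ n / ?r ^ n\<^sup>2)"
    using x r by (intro mult_mono 1 IH) auto
  also have "\<dots> = exp (x / (1 - ?r)) * (1 + x) ^ Suc n / ?r ^ (Suc n + n\<^sup>2)"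
    by (simp add: power_add mult_ac)
  also have "\<dots> \<le> exp (x / (1 - ?r)) * (1 + x) ^ Suc n / ?r ^ (Suc n)\<^sup>2"
  proof (rule divide_left_mono)
    show "?r ^ (Suc n)\<^sup>2 \<le> ?r ^ (Suc n + n\<^sup>2)"
      by (rule power_decreasing) (use norm_q_less_1 in \<open>simp_all add: power2_eq_square\<close>)
    show "0 \<le> exp (x / (1 - ?r)) * (1 + x) ^ Suc n"
      using x by simp
    show "0 < ?r ^ (Suc n + n\<^sup>2) * ?r ^ (Suc n)\<^sup>2"
      using norm_q_pos by (simp del: power_Suc)
  qed
  finally show ?case .
qed

end

section \<open>Convergence of the bilateral sums\<close>

text \<open>The factors that multiply the theta-like weight may grow like a power of \<open>|z|\<close> at \<open>\<infinity>\<close> and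
like a power of \<open>1/|z|\<close> at \<open>0\<close>. This class contains the polynomials in \<open>z - 1/z\<close> and is closed
under the operations that the telescoping argument uses.\<close>

definition moderate :: "(complex \<Rightarrow> complex) \<Rightarrow> bool" where
  "moderate f \<longleftrightarrow> (\<exists>C N. \<forall>z. z \<noteq> 0 \<longrightarrow> norm (f z) \<le> C * (norm z + 1 / norm z) ^ N)"

lemma moderateI:
  "(\<And>z. z \<noteq> 0 \<Longrightarrow> norm (f z) \<le> C * (norm z + 1 / norm z) ^ N) \<Longrightarrow> moderate f"
  unfolding moderate_def by blast

lemma add_inverse_ge_1: "1 \<le> x + 1 / x" if "0 < x" for x :: real
proof (cases "1 \<le> x")
  case False
  then have "1 \<le> 1 / x" using that by simp
  then show ?thesis using that by linarith
next
  case True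
  moreover have "0 \<le> 1 / x" using that by simp
  ultimately show ?thesis by linarith
qed

lemma moderate_const [intro!]: "moderate (\<lambda>z. c)"
  by (rule moderateI[where C = "norm c" and N = 0]) simp

lemma moderate_ident [intro!]: "moderate (\<lambda>z. z)"
  by (rule moderateI[where C = 1 and N = 1]) simp

lemma moderate_inverse [intro!]: "moderate (\<lambda>z. 1 / z)"
  by (rule moderateI[where C = 1 and N = 1]) (simp add: norm_divide)

lemma moderate_add [intro!]:
  assumes "moderate f" "moderate g"
  shows "moderate (\<lambda>z. f z + g z)"
proof -
  obtain C N where 1: "\<And>z. z \<noteq> 0 \<Longrightarrow> norm (f z) \<le> C * (norm z + 1 / norm z) ^ N"
    using assms(1) unfolding moderate_def by blast
  obtain D M where 2: "\<And>z. z \<noteq> 0 \<Longrightarrow> norm (g z) \<le> D * (norm z + 1 / norm z) ^ M"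
    using assms(2) unfolding moderate_def by blast
  show ?thesis
  proof (rule moderateI)
    fix z :: complex assume z: "z \<noteq> 0"
    let ?s = "norm z + 1 / norm z"
    have s: "1 \<le> ?s" using z by (intro add_inverse_ge_1) simp
    have "norm (f z + g z) \<le> norm (f z) + norm (g z)" by (rule norm_triangle_ineq)
    also have "\<dots> \<le> C * ?s ^ N + D * ?s ^ M" by (intro add_mono 1 2 z)
    also have "\<dots> \<le> \<bar>C\<bar> * ?s ^ (N + M) + \<bar>D\<bar> * ?s ^ (N + M)"
      using s by (intro add_mono mult_mono power_increasing) auto
    finally show "norm (f z + g z) \<le> (\<bar>C\<bar> + \<bar>D\<bar>) * ?s ^ (N + M)"
      by (simp add: distrib_right)
  qed
qed

lemma moderate_mult [intro!]:
  assumes "moderate f" "moderate g"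
  shows "moderate (\<lambda>z. f z * g z)"
proof -
  obtain C N where 1: "\<And>z. z \<noteq> 0 \<Longrightarrow> norm (f z) \<le> C * (norm z + 1 / norm z) ^ N"
    using assms(1) unfolding moderate_def by blast
  obtain D M where 2: "\<And>z. z \<noteq> 0 \<Longrightarrow> norm (g z) \<le> D * (norm z + 1 / norm z) ^ M"
    using assms(2) unfolding moderate_def by blast
  show ?thesis
  proof (rule moderateI)
    fix z :: complex assume z: "z \<noteq> 0"
    let ?s = "norm z + 1 / norm z"
    have "norm (f z) * norm (g z) \<le> (C * ?s ^ N) * (D * ?s ^ M)"
      by (intro mult_mono' 1 2 z) auto
    then show "norm (f z * g z) \<le> (C * D) * ?s ^ (N + M)"
      by (simp add: norm_mult power_add mult_ac)
  qed
qed

lemma moderate_uminus [intro!]: "moderate f \<Longrightarrow> moderate (\<lambda>z. - f z)"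
  using moderate_mult[OF moderate_const[of "-1"], of f] by simp

lemma moderate_diff [intro!]: "moderate f \<Longrightarrow> moderate g \<Longrightarrow> moderate (\<lambda>z. f z - g z)"
  using moderate_add[of f "\<lambda>z. - g z"] moderate_uminus[of g] by simp

lemma moderate_power [intro!]: "moderate f \<Longrightarrow> moderate (\<lambda>z. f z ^ n)"
  by (induction n) auto

lemma moderate_poly [intro!]: "moderate f \<Longrightarrow> moderate (\<lambda>z. poly p (f z))"
  by (induction p) auto

lemma summable_on_int_abs:
  fixes f :: "nat \<Rightarrow> real"
  assumes "summable f" "\<And>n. 0 \<le> f n"
  shows "(\<lambda>k::int. f (nat \<bar>k\<bar>)) summable_on UNIV"
proof -
  have f: "f summable_on UNIV"
    using assms by (intro summable_nonneg_imp_summable_on) auto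
  have "bij_betw int UNIV {0..}"
    by (rule bij_betwI[where g = nat]) auto
  then have "(\<lambda>k::int. f (nat \<bar>k\<bar>)) summable_on {0..}"
    by (rule summable_on_reindex_bij_betw[THEN iffD1]) (use f in simp)
  moreover have "bij_betw (\<lambda>n. - int n) UNIV {..0}"
    by (rule bij_betwI[where g = "\<lambda>k. nat (- k)"]) auto
  then have "(\<lambda>k::int. f (nat \<bar>k\<bar>)) summable_on {..0}"
    by (rule summable_on_reindex_bij_betw[THEN iffD1]) (use f in simp)
  ultimately have "(\<lambda>k::int. f (nat \<bar>k\<bar>)) summable_on ({0..} \<union> {..0})"
    by (rule summable_on_union)
  moreover have "{0..} \<union> {..0} = (UNIV :: int set)" by auto
  ultimately show ?thesis by simp
qed

text \<open>The common majorant of all bilateral sums: quadratic decay in the exponent beats any geometric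
growth \<open>D\<^sup>n\<close>, since \<open>D r\<^sup>n\<close> is eventually below \<open>1/2\<close>.\<close>

lemma summable_theta_majorant:
  fixes C D r :: real
  assumes "0 \<le> r" "r < 1" "0 \<le> C" "0 \<le> D"
  shows "(\<lambda>k::int. C * D ^ nat \<bar>k\<bar> * r ^ (nat \<bar>k\<bar>)\<^sup>2) summable_on UNIV"
proof -
  have "(\<lambda>n. D * r ^ n) \<longlonglongrightarrow> D * 0"
    by (intro tendsto_intros LIMSEQ_realpow_zero) (use assms in auto)
  then have "eventually (\<lambda>n. D * r ^ n < 1 / 2) sequentially"
    by (rule order_tendstoD) simp
  then have "eventually (\<lambda>n. norm (D ^ n * r ^ n\<^sup>2) \<le> (1 / 2) ^ n) sequentially"
  proof eventually_elim
    case (elim n)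
    have "D ^ n * r ^ n\<^sup>2 = (D * r ^ n) ^ n"
      by (simp add: power_mult_distrib power2_eq_square power_mult)
    also have "\<dots> \<le> (1 / 2) ^ n"
      using elim assms by (intro power_mono) auto
    finally show ?case using assms by simp
  qed
  then have "summable (\<lambda>n. D ^ n * r ^ n\<^sup>2)"
    by (rule summable_comparison_test_ev) (simp add: summable_geometric)
  then have "summable (\<lambda>n. C * (D ^ n * r ^ n\<^sup>2))"
    by (rule summable_mult)
  from summable_on_int_abs[OF this] show ?thesis
    using assms by (simp add: mult_ac)
qed

text \<open>Tannery's theorem, as dominated convergence for the counting measure.\<close>

lemma tendsto_infsum_dominated:
  fixes f :: "nat \<Rightarrow> 'a \<Rightarrow> 'b :: {banach, second_countable_topology}"
  assumes lim: "\<And>k. (\<lambda>n. f n k) \<longlonglongrightarrow> g k"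
      and bound: "\<And>n k. norm (f n k) \<le> M k"
      and M: "M summable_on UNIV"
  shows "(\<lambda>n. \<Sum>\<^sub>\<infinity>k. f n k) \<longlonglongrightarrow> (\<Sum>\<^sub>\<infinity>k. g k)"
proof -
  have M0: "0 \<le> M k" for k using bound[of 0 k] norm_ge_zero order_trans by blast
  have int_M: "integrable (count_space UNIV) M"
    using M M0 abs_summable_equivalent[of M UNIV] by (simp add: abs_summable_on_def)
  have bound_g: "norm (g k) \<le> M k" for k
    by (rule LIMSEQ_le_const2[OF tendsto_norm[OF lim]]) (use bound in auto)
  have eq: "(\<Sum>\<^sub>\<infinity>k. h k) = integral\<^sup>L (count_space UNIV) h" if "\<And>k. norm (h k) \<le> M k" for h :: "'a \<Rightarrow> 'b"
  proof -
    have "Infinite_Set_Sum.abs_summable_on h UNIV"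
      unfolding abs_summable_on_def using int_M by (rule Bochner_Integration.integrable_bound) (use that M0 in auto)
    then show ?thesis by (simp add: infsetsum_infsum[symmetric] infsetsum_def)
  qed
  have "(\<lambda>n. integral\<^sup>L (count_space UNIV) (f n)) \<longlonglongrightarrow> integral\<^sup>L (count_space UNIV) g"
    by (rule integral_dominated_convergence[where w = M]) (use int_M lim bound in auto)
  then show ?thesis by (simp add: eq bound bound_g)
qed

context nome
begin

definition weight :: "complex \<Rightarrow> complex \<Rightarrow> complex" where
  "weight a z = qpoch_inf [- (q * a * z), q * a / z] q"

definition lattice_gauss :: "complex \<Rightarrow> int \<Rightarrow> complex" where
  "lattice_gauss \<beta> k = q powi (2 * k\<^sup>2 - k) * \<beta> powi (4 * k)"

text \<open>The factor \<open>1 + z\<^sup>2\<close> of the theorem is part of \<open>f\<close>: the telescoping sequence below has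
this shape without that factor.\<close>

definition summand :: "(complex \<Rightarrow> complex) \<Rightarrow> complex \<Rightarrow> complex \<Rightarrow> int \<Rightarrow> complex" where
  "summand f a \<beta> k = f (q powi k * \<beta>) * weight a (q powi k * \<beta>) * lattice_gauss \<beta> k"

definition bisum :: "(complex \<Rightarrow> complex) \<Rightarrow> complex \<Rightarrow> complex \<Rightarrow> complex" where
  "bisum f a \<beta> = (\<Sum>\<^sub>\<infinity>k. summand f a \<beta> k)"

lemmas summable_majorant = summable_theta_majorant[OF norm_ge_zero norm_q_less_1]

text \<open>At \<open>z = q\<^sup>k \<beta>\<close> only one of the two infinite products in the weight has a large argument,
so the weight is of size at most \<open>|q|\<close> to the power \<open>-k\<^sup>2\<close> up to a geometric factor, while
the Gaussian factor is of size \<open>|q|\<close> to the power \<open>2k\<^sup>2\<close>. The constants are uniform in \<open>\<beta>\<close> and \<open>a\<close>: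
uniformity in \<open>a\<close> serves the limit \<open>a \<rightarrow> 0\<close>, uniformity in \<open>\<beta>\<close> the integration over \<open>\<beta>\<close>.\<close>

lemma summand_bound:
  assumes "moderate f" "1 \<le> B" "0 \<le> S"
  obtains C D where "0 \<le> C" "0 \<le> D"
    "\<And>\<beta> a k. \<beta> \<noteq> 0 \<Longrightarrow> norm \<beta> \<le> B \<Longrightarrow> 1 / norm \<beta> \<le> B \<Longrightarrow> norm a \<le> S \<Longrightarrow>
       norm (summand f a \<beta> k) \<le> C * D ^ nat \<bar>k\<bar> * norm q ^ (nat \<bar>k\<bar>)\<^sup>2"
proof -
  let ?r = "norm q"
  obtain C N where f: "\<And>z. z \<noteq> 0 \<Longrightarrow> norm (f z) \<le> C * (norm z + 1 / norm z) ^ N"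
    using assms(1) unfolding moderate_def by blast
  define x where "x = S * B"
  define E where "E = exp (x / (1 - ?r))"
  have x: "0 \<le> x" and E: "0 < E" using assms by (auto simp: x_def E_def)
  have r: "0 < ?r" "?r < 1" by (rule norm_q_pos norm_q_less_1)+
  show thesis
  proof (rule that)
    show "0 \<le> \<bar>C\<bar> * (2 * B) ^ N * E\<^sup>2" using assms by simp
    show "0 \<le> (1 + x) * B ^ 4 / ?r ^ (N + 1)" using assms x by simp
    fix \<beta> a :: complex and k :: int
    assume \<beta>: "\<beta> \<noteq> 0" "norm \<beta> \<le> B" "1 / norm \<beta> \<le> B" and a: "norm a \<le> S"
    define n where "n = nat \<bar>k\<bar>"
    define z where "z = q powi k * \<beta>"
    have z0: "z \<noteq> 0" using \<beta> by (simp add: z_def)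
    have rn: "0 < ?r ^ n" "?r ^ n \<le> 1" using r by (auto intro: power_le_one)
    have B_le: "B \<le> B / ?r ^ n" using rn assms by (simp add: field_simps)
    have rn': "B * ?r ^ n \<le> B" using rn assms by (simp add: mult_left_le)
    have az: "norm (q * a * z) \<le> S * t" if "norm z \<le> t" for t
    proof -
      have "norm (q * a * z) = ?r * (norm a * norm z)" by (simp add: norm_mult mult_ac)
      also have "\<dots> \<le> 1 * (norm a * norm z)" using r by (intro mult_right_mono) auto
      also have "\<dots> \<le> S * t" using a that assms by (auto intro!: mult_mono)
      finally show ?thesis .
    qed
    have az': "norm (q * a / z) \<le> S * t" if "1 / norm z \<le> t" for t
    proof -
      have "norm (q * a / z) = ?r * (norm a * (1 / norm z))" by (simp add: norm_mult norm_divide)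
      also have "\<dots> \<le> 1 * (norm a * (1 / norm z))" using r by (intro mult_right_mono) auto
      also have "\<dots> \<le> S * t" using a that assms by (auto intro!: mult_mono simp del: times_divide_eq_right)
      finally show ?thesis .
    qed
    have grow: "norm (qpoch_inf [y] q) \<le> E * (1 + x) ^ n / ?r ^ n\<^sup>2" if "norm y \<le> S * (B / ?r ^ n)" for y
      using norm_qpoch_inf_growth[of y x n] that by (simp add: x_def E_def)
    have small: "norm (qpoch_inf [y] q) \<le> E" if "norm y \<le> S * B" for y
      unfolding E_def x_def using that r
      by (intro order_trans[OF norm_qpoch_inf_le]) (simp add: divide_right_mono)
    \<comment> \<open>Both signs of \<open>k\<close> lead to the same bounds; they differ in which of
        \<open>z\<close> and \<open>1/z\<close> stays bounded.\<close>
    have zz: "norm z \<le> B / ?r ^ n \<and> 1 / norm z \<le> B / ?r ^ n \<and>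
        norm (weight a z) \<le> E * (E * (1 + x) ^ n / ?r ^ n\<^sup>2) \<and>
        norm (lattice_gauss \<beta> k) \<le> ?r ^ (2 * n\<^sup>2) / ?r ^ n * B ^ (4 * n)"
    proof (cases "0 \<le> k")
      case True
      then have k: "k = int n" by (simp add: n_def)
      have nz: "norm z = ?r ^ n * norm \<beta>" by (simp add: z_def k norm_mult norm_power)
      have "norm z \<le> 1 * B" unfolding nz using rn \<beta> by (intro mult_mono) auto
      then have 1: "norm z \<le> B" by simp
      have "1 / norm z = 1 / norm \<beta> / ?r ^ n" by (simp add: nz)
      also have "\<dots> \<le> B / ?r ^ n" using rn \<beta> by (intro divide_right_mono) auto
      finally have 2: "1 / norm z \<le> B / ?r ^ n" .
      have b4: "\<beta> powi (4 * int n) = \<beta> ^ (4 * n)"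
        using power_int_of_nat[of \<beta> "4 * n"] by simp
      have "2 * k\<^sup>2 - k = int (2 * n\<^sup>2) - int n" by (simp add: k)
      then have "norm (lattice_gauss \<beta> k) = ?r ^ (2 * n\<^sup>2) / ?r ^ n * norm \<beta> ^ (4 * n)"
        using b4
        by (simp add: lattice_gauss_def k norm_mult norm_power norm_divide power_int_diff power_int_of_nat del: of_nat_mult of_nat_power)
      also have "\<dots> \<le> ?r ^ (2 * n\<^sup>2) / ?r ^ n * B ^ (4 * n)"
        using \<beta> by (intro mult_left_mono power_mono) auto
      finally have 3: "norm (lattice_gauss \<beta> k) \<le> ?r ^ (2 * n\<^sup>2) / ?r ^ n * B ^ (4 * n)" .
      have "norm (weight a z) \<le> E * (E * (1 + x) ^ n / ?r ^ n\<^sup>2)"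
        unfolding weight_def qpoch_inf_Cons[of _ "[_]"] norm_mult
        using E x by (intro mult_mono small grow) (use az[OF 1] az'[OF 2] in auto)
      then show ?thesis using 1 2 3 B_le by auto
    next
      case False
      then have k: "k = - int n" by (simp add: n_def)
      have nz: "norm z = norm \<beta> / ?r ^ n" by (simp add: z_def k norm_mult norm_power power_int_minus norm_inverse norm_divide divide_inverse)
      have "norm z \<le> B / ?r ^ n" unfolding nz using rn \<beta> by (intro divide_right_mono) auto
      then have 1: "norm z \<le> B / ?r ^ n" by simp
      have "1 / norm z = ?r ^ n * (1 / norm \<beta>)" by (simp add: nz)
      also have "\<dots> \<le> 1 * B" using rn \<beta> by (intro mult_mono) auto
      finally have 2: "1 / norm z \<le> B" by simp
      have b4: "\<beta> powi - (4 * int n) = 1 / \<beta> ^ (4 * n)"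
        using power_int_minus[of \<beta> "int (4 * n)"]
        by (simp add: power_int_of_nat inverse_eq_divide del: of_nat_mult) simp
      have "2 * k\<^sup>2 - k = int (2 * n\<^sup>2 + n)" by (simp add: k)
      then have "norm (lattice_gauss \<beta> k) = ?r ^ (2 * n\<^sup>2 + n) * (1 / norm \<beta>) ^ (4 * n)"
        using b4
        by (simp add: lattice_gauss_def k norm_mult norm_power norm_inverse norm_divide power_int_of_nat power_one_over inverse_eq_divide del: of_nat_mult of_nat_power of_nat_add)
      also have "\<dots> \<le> ?r ^ (2 * n\<^sup>2) / ?r ^ n * B ^ (4 * n)"
      proof (intro mult_mono power_mono \<beta>)
        have "?r ^ (2 * n\<^sup>2 + n) \<le> ?r ^ (2 * n\<^sup>2)" using r by (intro power_decreasing) auto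
        also have "\<dots> \<le> ?r ^ (2 * n\<^sup>2) / ?r ^ n" using rn by (simp add: field_simps)
        finally show "?r ^ (2 * n\<^sup>2 + n) \<le> ?r ^ (2 * n\<^sup>2) / ?r ^ n" .
      qed auto
      finally have 3: "norm (lattice_gauss \<beta> k) \<le> ?r ^ (2 * n\<^sup>2) / ?r ^ n * B ^ (4 * n)" .
      have "norm (weight a z) \<le> (E * (1 + x) ^ n / ?r ^ n\<^sup>2) * E"
        unfolding weight_def qpoch_inf_Cons[of _ "[_]"] norm_mult
        using E x by (intro mult_mono small grow) (use az[OF 1] az'[OF 2] in auto)
      then show ?thesis using 1 2 3 B_le by (auto simp: mult.commute)
    qed
    have "norm (f z) \<le> \<bar>C\<bar> * (norm z + 1 / norm z) ^ N"
      using f[OF z0] by (rule order_trans) (intro mult_right_mono, auto)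
    also have "\<dots> \<le> \<bar>C\<bar> * (2 * B / ?r ^ n) ^ N"
      using zz by (intro mult_left_mono power_mono) auto
    finally have fz: "norm (f z) \<le> \<bar>C\<bar> * (2 * B / ?r ^ n) ^ N" .
    have "norm (summand f a \<beta> k) = norm (f z) * norm (weight a z) * norm (lattice_gauss \<beta> k)"
      by (simp add: summand_def z_def norm_mult)
    also have "\<dots> \<le> (\<bar>C\<bar> * (2 * B / ?r ^ n) ^ N) * (E * (E * (1 + x) ^ n / ?r ^ n\<^sup>2)) * (?r ^ (2 * n\<^sup>2) / ?r ^ n * B ^ (4 * n))"
      using zz E x assms by (intro mult_mono fz) auto
    also have "\<dots> = \<bar>C\<bar> * (2 * B) ^ N * E\<^sup>2 * ((1 + x) * B ^ 4 / ?r ^ (N + 1)) ^ n * ?r ^ n\<^sup>2"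
    proof -
      have "?r ^ (2 * n\<^sup>2) = ?r ^ n\<^sup>2 * ?r ^ n\<^sup>2" by (simp add: mult_2 power_add)
      then show ?thesis
        using r by (simp add: power_mult_distrib power_divide power_add power2_eq_square mult_ac
            flip: power_mult)
    qed
    finally show "norm (summand f a \<beta> k) \<le> \<bar>C\<bar> * (2 * B) ^ N * E\<^sup>2
        * ((1 + x) * B ^ 4 / ?r ^ (N + 1)) ^ nat \<bar>k\<bar> * ?r ^ (nat \<bar>k\<bar>)\<^sup>2"
      by (simp only: n_def)
  qed
qed

lemma norm_summable_summand:
  assumes "moderate f" "\<beta> \<noteq> 0"
  shows "(\<lambda>k. norm (summand f a \<beta> k)) summable_on UNIV"
proof -
  define B where "B = max 1 (max (norm \<beta>) (1 / norm \<beta>))"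
  have "1 \<le> B" "norm \<beta> \<le> B" "1 / norm \<beta> \<le> B" by (auto simp: B_def)
  from summand_bound[OF assms(1) \<open>1 \<le> B\<close> norm_ge_zero[of a]]
  obtain C D where CD: "0 \<le> C" "0 \<le> D"
    "\<And>\<beta>' a' k. \<beta>' \<noteq> 0 \<Longrightarrow> norm \<beta>' \<le> B \<Longrightarrow> 1 / norm \<beta>' \<le> B \<Longrightarrow> norm a' \<le> norm a \<Longrightarrow>
       norm (summand f a' \<beta>' k) \<le> C * D ^ nat \<bar>k\<bar> * norm q ^ (nat \<bar>k\<bar>)\<^sup>2" by blast
  show ?thesis
    by (rule summable_on_comparison_test[OF summable_majorant[OF CD(1,2)]])
       (use CD(3) assms(2) \<open>norm \<beta> \<le> B\<close> \<open>1 / norm \<beta> \<le> B\<close> in auto)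
qed

lemma summable_summand:
  assumes "moderate f" "\<beta> \<noteq> 0"
  shows "summand f a \<beta> summable_on UNIV"
  using norm_summable_summand[OF assms] by (rule abs_summable_summable)

lemma weight_0 [simp]: "weight 0 z = 1"
proof -
  have "qpoch_inf [0] q = 1" by (simp add: qpoch_inf_def)
  then show ?thesis by (simp add: weight_def qpoch_inf_Cons[of _ "[_]"])
qed

text \<open>The two factors that this shift adds, \<open>1 + a z\<close> and \<open>1 - a/z\<close>, multiply to a function of
\<open>z - 1/z\<close>.\<close>

lemma weight_divide_q:
  "weight (a / q) z = (1 + a * (z - 1 / z) - a\<^sup>2) * weight a z" if "z \<noteq> 0"
proof -
  have "weight (a / q) z = qpoch_inf [- (a * z)] q * qpoch_inf [a / z] q"
    by (simp add: weight_def qpoch_inf_Cons[of _ "[_]"])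
  also have "\<dots> = ((1 + a * z) * (1 - a / z)) * weight a z"
    unfolding weight_def qpoch_inf_Cons[of _ "[_]"]
    by (subst (1 2) qpoch_inf_shift) (simp add: mult_ac)
  also have "(1 + a * z) * (1 - a / z) = 1 + a * (z - 1 / z) - a\<^sup>2"
    using that by (simp add: field_simps power2_eq_square)
  finally show ?thesis .
qed

lemma weight_shift:
  "(1 + q * a * z) * weight a (q * z) = (1 - a / z) * weight a z"
proof -
  have "(1 + q * a * z) * qpoch_inf [- (q * a * (q * z))] q = qpoch_inf [- (q * a * z)] q"
    by (subst (2) qpoch_inf_shift) (simp add: mult_ac)
  moreover have "qpoch_inf [q * a / (q * z)] q = (1 - a / z) * qpoch_inf [q * a / z] q"
    by (subst qpoch_inf_shift) simp
  ultimately show ?thesis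
    unfolding weight_def qpoch_inf_Cons[of _ "[_]"] by (metis mult.assoc mult.commute)
qed

lemma lattice_gauss_shift:
  assumes "\<beta> \<noteq> 0"
  shows "lattice_gauss \<beta> (k + 1) = q * (q powi k * \<beta>) ^ 4 * lattice_gauss \<beta> k"
proof -
  have "2 * (k + 1)\<^sup>2 - (k + 1) = 1 + k * 4 + (2 * k\<^sup>2 - k)"
    by (simp add: power2_eq_square algebra_simps)
  moreover have "q powi (1 + k * 4 + m) = q * (q powi k) ^ 4 * q powi m" for m
    by (simp add: power_int_add power_int_mult)
  ultimately have 1: "q powi (2 * (k + 1)\<^sup>2 - (k + 1)) = q * (q powi k) ^ 4 * q powi (2 * k\<^sup>2 - k)"
    by (simp only:)
  have "\<beta> powi (4 * (k + 1)) = \<beta> powi (4 * k) * \<beta> ^ 4"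
    using assms by (simp add: distrib_left power_int_add)
  then show ?thesis
    unfolding lattice_gauss_def 1 by (simp add: power_mult_distrib mult_ac)
qed

lemma infsum_shift_int: "(\<Sum>\<^sub>\<infinity>k::int. f (k + 1)) = (\<Sum>\<^sub>\<infinity>k. f k)" for f :: "int \<Rightarrow> complex"
  by (rule infsum_reindex_bij_betw) (rule bij_betwI[where g = "\<lambda>k. k - 1"], auto)

lemma summable_shift_int: "f summable_on UNIV \<Longrightarrow> (\<lambda>k::int. f (k + 1)) summable_on UNIV" for f :: "int \<Rightarrow> complex"
  by (rule summable_on_reindex_bij_betw[THEN iffD2, rotated, of f])
     (auto intro: bij_betwI[where g = "\<lambda>k. k - 1"])

lemma bisum_add:
  assumes "moderate f" "moderate g" "\<beta> \<noteq> 0"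
  shows "bisum (\<lambda>z. f z + g z) a \<beta> = bisum f a \<beta> + bisum g a \<beta>"
proof -
  have "summand (\<lambda>z. f z + g z) a \<beta> = (\<lambda>k. summand f a \<beta> k + summand g a \<beta> k)"
    by (simp add: summand_def distrib_right fun_eq_iff)
  then show ?thesis
    unfolding bisum_def by (simp add: infsum_add summable_summand assms)
qed

lemma bisum_cmult: "bisum (\<lambda>z. c * f z) a \<beta> = c * bisum f a \<beta>"
proof -
  have "summand (\<lambda>z. c * f z) a \<beta> = (\<lambda>k. c * summand f a \<beta> k)"
    by (simp add: summand_def fun_eq_iff)
  then show ?thesis by (simp add: bisum_def infsum_cmult_right')
qed

lemma bisum_cong:
  assumes "\<And>z. z \<noteq> 0 \<Longrightarrow> f z * weight a z = g z * weight b z" "\<beta> \<noteq> 0"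
  shows "bisum f a \<beta> = bisum g b \<beta>"
  unfolding bisum_def summand_def using assms by (intro infsum_cong) simp

section \<open>Independence of the parameter, and the moments\<close>

text \<open>The sequence \<open>(1/z + a) W(a; z)\<close> times the Gaussian factor telescopes. Passing from \<open>z\<close> to
\<open>q z\<close> multiplies the Gaussian factor by \<open>q z\<^sup>4\<close> and exchanges the factor \<open>1 + q a z\<close> of the weight
for \<open>1 - a/z\<close>, so the difference of consecutive terms has the factor
\<open>z\<^sup>3 - a z\<^sup>2 - 1/z - a = (1 + z\<^sup>2) (z - 1/z - a)\<close>.\<close>

lemma bisum_telescope:
  assumes \<beta>: "\<beta> \<noteq> 0"
  shows "bisum (\<lambda>z. (1 + z\<^sup>2) * (z - 1 / z - a)) a \<beta> = 0"
proof -
  define g where "g = summand (\<lambda>z. 1 / z + a) a \<beta>"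
  have g: "g summable_on UNIV" unfolding g_def by (rule summable_summand) (use \<beta> in auto)
  have "summand (\<lambda>z. (1 + z\<^sup>2) * (z - 1 / z - a)) a \<beta> k = g (k + 1) - g k" for k
  proof -
    define z where "z = q powi k * \<beta>"
    have z: "z \<noteq> 0" using \<beta> by (simp add: z_def)
    have qz: "q powi (k + 1) * \<beta> = q * z" by (simp add: z_def power_int_add)
    have "g (k + 1) = (1 / (q * z) + a) * weight a (q * z) * (q * z ^ 4 * lattice_gauss \<beta> k)"
      unfolding g_def summand_def qz lattice_gauss_shift[OF \<beta>] by (simp add: z_def)
    also have "\<dots> = ((1 + q * a * z) * weight a (q * z)) * (z ^ 3 * lattice_gauss \<beta> k)"
      using z by (simp add: field_simps power_numeral_reduce)
    also have "\<dots> = (1 - a / z) * z ^ 3 * (weight a z * lattice_gauss \<beta> k)"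
      unfolding weight_shift by (simp add: mult_ac)
    finally have "g (k + 1) = (1 - a / z) * z ^ 3 * (weight a z * lattice_gauss \<beta> k)" .
    moreover have "g k = (1 / z + a) * (weight a z * lattice_gauss \<beta> k)"
      by (simp only: g_def summand_def z_def mult.assoc)
    ultimately have "g (k + 1) - g k = ((1 - a / z) * z ^ 3 - (1 / z + a)) * (weight a z * lattice_gauss \<beta> k)"
      by (simp only: left_diff_distrib)
    also have "(1 - a / z) * z ^ 3 - (1 / z + a) = (1 + z\<^sup>2) * (z - 1 / z - a)"
      using z by (simp add: field_simps power2_eq_square power3_eq_cube)
    finally show ?thesis by (simp add: summand_def z_def mult_ac)
  qed
  then have "bisum (\<lambda>z. (1 + z\<^sup>2) * (z - 1 / z - a)) a \<beta> = (\<Sum>\<^sub>\<infinity>k. g (k + 1) - g k)"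
    by (simp add: bisum_def)
  also have "\<dots> = (\<Sum>\<^sub>\<infinity>k. g (k + 1)) - (\<Sum>\<^sub>\<infinity>k. g k)"
    using infsum_add[OF summable_shift_int[OF g] summable_on_uminus[THEN iffD2, OF g]] by (simp add: infsum_uminus)
  also have "\<dots> = 0" by (simp add: infsum_shift_int)
  finally show ?thesis .
qed

lemma bisum_divide_q:
  assumes "\<beta> \<noteq> 0"
  shows "bisum (\<lambda>z. 1 + z\<^sup>2) (a / q) \<beta> = bisum (\<lambda>z. 1 + z\<^sup>2) a \<beta>"
proof -
  have expand: "(1 + z\<^sup>2) * (1 + a * u - a\<^sup>2) = (1 + z\<^sup>2) + a * ((1 + z\<^sup>2) * (u - a))" for u z
    by (simp add: algebra_simps power2_eq_square)
  have "bisum (\<lambda>z. 1 + z\<^sup>2) (a / q) \<beta> =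
      bisum (\<lambda>z. (1 + z\<^sup>2) + a * ((1 + z\<^sup>2) * (z - 1 / z - a))) a \<beta>"
    by (rule bisum_cong[OF _ assms])
       (simp only: weight_divide_q expand[symmetric] mult.assoc not_False_eq_True)
  also have "\<dots> = bisum (\<lambda>z. 1 + z\<^sup>2) a \<beta> + bisum (\<lambda>z. a * ((1 + z\<^sup>2) * (z - 1 / z - a))) a \<beta>"
    by (rule bisum_add) (use assms in auto)
  finally show ?thesis by (simp add: bisum_cmult bisum_telescope assms)
qed

text \<open>Invariance under \<open>a \<mapsto> a q\<close> and continuity at \<open>a = 0\<close> along \<open>a q\<^sup>N\<close>.\<close>

lemma bisum_independent:
  assumes \<beta>: "\<beta> \<noteq> 0"
  shows "bisum (\<lambda>z. 1 + z\<^sup>2) a \<beta> = bisum (\<lambda>z. 1 + z\<^sup>2) 0 \<beta>"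
proof -
  have const: "bisum (\<lambda>z. 1 + z\<^sup>2) (a * q ^ N) \<beta> = bisum (\<lambda>z. 1 + z\<^sup>2) a \<beta>" for N
  proof (induction N)
    case (Suc N)
    then show ?case using bisum_divide_q[OF \<beta>, of "a * q ^ Suc N"] by (simp add: mult_ac)
  qed simp
  have aq: "(\<lambda>N. a * q ^ N) \<longlonglongrightarrow> 0"
    using LIMSEQ_power_zero[OF norm_q_less_1] by (rule tendsto_mult_right_zero)
  define B where "B = max 1 (max (norm \<beta>) (1 / norm \<beta>))"
  have B: "1 \<le> B" "norm \<beta> \<le> B" "1 / norm \<beta> \<le> B" by (auto simp: B_def)
  have "moderate (\<lambda>z. 1 + z\<^sup>2)" by auto
  from summand_bound[OF this \<open>1 \<le> B\<close> norm_ge_zero[of a]]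
  obtain C D where CD: "0 \<le> C" "0 \<le> D"
    "\<And>\<beta>' a' k. \<beta>' \<noteq> 0 \<Longrightarrow> norm \<beta>' \<le> B \<Longrightarrow> 1 / norm \<beta>' \<le> B \<Longrightarrow> norm a' \<le> norm a \<Longrightarrow>
       norm (summand (\<lambda>z. 1 + z\<^sup>2) a' \<beta>' k) \<le> C * D ^ nat \<bar>k\<bar> * norm q ^ (nat \<bar>k\<bar>)\<^sup>2" by blast
  have "(\<lambda>N. bisum (\<lambda>z. 1 + z\<^sup>2) (a * q ^ N) \<beta>) \<longlonglongrightarrow> bisum (\<lambda>z. 1 + z\<^sup>2) 0 \<beta>"
    unfolding bisum_def
  proof (rule tendsto_infsum_dominated[OF _ _ summable_majorant[OF CD(1,2)]])
    show "norm (summand (\<lambda>z. 1 + z\<^sup>2) (a * q ^ N) \<beta> k) \<le> C * D ^ nat \<bar>k\<bar> * norm q ^ (nat \<bar>k\<bar>)\<^sup>2" for N k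
    proof (rule CD(3)[OF \<beta> B(2,3)])
      have "norm a * norm q ^ N \<le> norm a * 1"
        by (intro mult_left_mono power_le_one) (use norm_q_less_1 in auto)
      then show "norm (a * q ^ N) \<le> norm a" by (simp add: norm_mult norm_power)
    qed
    fix k
    let ?z = "q powi k * \<beta>"
    have w: "(\<lambda>N. weight (a * q ^ N) ?z) \<longlonglongrightarrow> 1 * 1"
      unfolding weight_def qpoch_inf_Cons[of _ "[_]"]
    proof (intro tendsto_mult qpoch_inf_tendsto_1)
      show "(\<lambda>N. - (q * (a * q ^ N) * ?z)) \<longlonglongrightarrow> 0"
        by (auto intro!: tendsto_eq_intros aq simp: norm_q_less_1)
      show "(\<lambda>N. q * (a * q ^ N) / ?z) \<longlonglongrightarrow> 0"
        using \<beta> by (auto intro!: tendsto_eq_intros aq simp: norm_q_less_1)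
    qed
    show "(\<lambda>N. summand (\<lambda>z. 1 + z\<^sup>2) (a * q ^ N) \<beta> k) \<longlonglongrightarrow> summand (\<lambda>z. 1 + z\<^sup>2) 0 \<beta> k"
      unfolding summand_def using w by (intro tendsto_intros) simp
  qed
  then have "(\<lambda>N. bisum (\<lambda>z. 1 + z\<^sup>2) a \<beta>) \<longlonglongrightarrow> bisum (\<lambda>z. 1 + z\<^sup>2) 0 \<beta>"
    by (simp only: const)
  then show ?thesis by (simp add: LIMSEQ_const_iff)
qed

text \<open>If \<open>P\<close> describes the sums for \<open>p'\<close>, then the relation between the weights of parameters \<open>a/q\<close>
and \<open>a\<close> describes those for \<open>y p'(y)\<close> by
\<open>(P(a/q) - P(a))/a + a P(a)\<close>. The first quotient is a polynomial of smaller degree than \<open>P\<close>,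
the second summand raises the degree by one and preserves the leading coefficient.\<close>

lemma bisum_poly:
  assumes \<beta>: "\<beta> \<noteq> 0" and "degree p \<le> n"
  shows "\<exists>P. degree P \<le> n \<and> coeff P n = coeff p n \<and>
           (\<forall>a. a \<noteq> 0 \<longrightarrow> bisum (\<lambda>z. (1 + z\<^sup>2) * poly p (z - 1 / z)) a \<beta> =
             bisum (\<lambda>z. 1 + z\<^sup>2) 0 \<beta> * poly P a)"
  using assms(2)
proof (induction n arbitrary: p)
  case 0
  then have "degree p = 0" by simp
  then obtain c where p: "p = [:c:]" by (rule degree_eq_zeroE)
  have "bisum (\<lambda>z. (1 + z\<^sup>2) * c) a \<beta> = bisum (\<lambda>z. 1 + z\<^sup>2) 0 \<beta> * c" for a
    using bisum_cmult[of c "\<lambda>z. 1 + z\<^sup>2"] by (simp add: mult.commute bisum_independent[OF \<beta>, of a])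
  then show ?case by (intro exI[of _ p]) (simp add: p)
next
  case (Suc n)
  define c where "c = coeff p 0"
  obtain p' where p: "p = pCons c p'" by (cases p) (auto simp: c_def)
  have "degree p' \<le> n" using Suc.prems by (auto simp: p split: if_splits)
  from Suc.IH[OF this] obtain P where P: "degree P \<le> n" "coeff P n = coeff p' n"
    "\<And>a. a \<noteq> 0 \<Longrightarrow> bisum (\<lambda>z. (1 + z\<^sup>2) * poly p' (z - 1 / z)) a \<beta> =
             bisum (\<lambda>z. 1 + z\<^sup>2) 0 \<beta> * poly P a" by blast
  \<comment> \<open>\<open>R(a) = P(a/q) - P(a)\<close> vanishes at \<open>0\<close>, so it can be divided by \<open>a\<close>.\<close>
  define R where "R = pcompose P [:0, 1 / q:] - P"
  have "poly R 0 = 0" by (simp add: R_def poly_pcompose)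
  then obtain R' where R': "R = pCons 0 R'" by (cases R) auto
  have "degree R \<le> n"
    unfolding R_def using P(1) by (intro degree_diff_le) (auto simp: degree_pcompose)
  then have R'n: "degree R' \<le> n" "coeff R' (Suc n) = 0" "coeff R' n = coeff R (Suc n)"
    using R' by (auto split: if_splits intro: coeff_eq_0)
  have "coeff R (Suc n) = 0" using \<open>degree R \<le> n\<close> by (intro coeff_eq_0) auto
  define P' where "P' = [:c:] + R' + pCons 0 P"
  have "degree P' \<le> Suc n"
    unfolding P'_def using R'n P(1) by (intro degree_add_le) (auto simp: degree_pCons_eq_if)
  moreover have "coeff P' (Suc n) = coeff p (Suc n)"
    using R'n P(2) by (simp add: P'_def p)
  moreover have "bisum (\<lambda>z. (1 + z\<^sup>2) * poly p (z - 1 / z)) a \<beta> =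
             bisum (\<lambda>z. 1 + z\<^sup>2) 0 \<beta> * poly P' a" if a: "a \<noteq> 0" for a
  proof -
    let ?f = "\<lambda>z. (1 + z\<^sup>2) * poly p' (z - 1 / z)"
    let ?\<mu> = "bisum (\<lambda>z. 1 + z\<^sup>2) 0 \<beta>"
    have f: "moderate ?f" by auto
    have expand: "(1 + z\<^sup>2) * (c + y * x) = c * (1 + z\<^sup>2) + y * ((1 + z\<^sup>2) * x)" for x y z
      by (simp add: algebra_simps)
    have "bisum (\<lambda>z. (1 + z\<^sup>2) * poly p (z - 1 / z)) a \<beta> =
        bisum (\<lambda>z. c * (1 + z\<^sup>2) + (z - 1 / z) * ?f z) a \<beta>"
      unfolding p poly_pCons expand ..
    also have "\<dots> = c * bisum (\<lambda>z. 1 + z\<^sup>2) a \<beta> + bisum (\<lambda>z. (z - 1 / z) * ?f z) a \<beta>"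
      unfolding bisum_cmult[symmetric] by (rule bisum_add) (use \<beta> in auto)
    also have "bisum (\<lambda>z. 1 + z\<^sup>2) a \<beta> = ?\<mu>"
      by (rule bisum_independent[OF \<beta>])
    finally have 1: "bisum (\<lambda>z. (1 + z\<^sup>2) * poly p (z - 1 / z)) a \<beta> =
        c * ?\<mu> + bisum (\<lambda>z. (z - 1 / z) * ?f z) a \<beta>" .
    have "bisum ?f (a / q) \<beta> = bisum (\<lambda>z. (1 - a\<^sup>2) * ?f z + a * ((z - 1 / z) * ?f z)) a \<beta>"
      by (rule bisum_cong[OF _ \<beta>]) (simp add: weight_divide_q algebra_simps)
    also have "\<dots> = (1 - a\<^sup>2) * bisum ?f a \<beta> + a * bisum (\<lambda>z. (z - 1 / z) * ?f z) a \<beta>"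
      unfolding bisum_cmult[symmetric] by (rule bisum_add) (use \<beta> in auto)
    finally have "a * bisum (\<lambda>z. (z - 1 / z) * ?f z) a \<beta> = ?\<mu> * (poly P (a / q) - (1 - a\<^sup>2) * poly P a)"
      using P(3)[OF a] P(3)[of "a / q"] a by (simp add: algebra_simps)
    also have "poly P (a / q) - (1 - a\<^sup>2) * poly P a = poly R a + a * (a * poly P a)"
      by (simp add: R_def poly_pcompose algebra_simps power2_eq_square)
    also have "\<dots> = a * (poly R' a + a * poly P a)"
      by (simp add: R' algebra_simps)
    finally have "bisum (\<lambda>z. (z - 1 / z) * ?f z) a \<beta> = ?\<mu> * (poly R' a + a * poly P a)"
      using a by simp
    then show ?thesis unfolding 1 by (simp add: P'_def algebra_simps)
  qed
  ultimately show ?case by blast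
qed

end

section \<open>The q-binomial theorem and orthogonality\<close>

lemma infsum_finite_sum:
  fixes f :: "'i \<Rightarrow> 'a \<Rightarrow> complex"
  assumes "finite I" "\<And>i. f i summable_on A"
  shows "(\<Sum>\<^sub>\<infinity>x\<in>A. \<Sum>i\<in>I. f i x) = (\<Sum>i\<in>I. \<Sum>\<^sub>\<infinity>x\<in>A. f i x)"
proof -
  have "(\<lambda>x. \<Sum>i\<in>I. f i x) summable_on A \<and>
      (\<Sum>\<^sub>\<infinity>x\<in>A. \<Sum>i\<in>I. f i x) = (\<Sum>i\<in>I. \<Sum>\<^sub>\<infinity>x\<in>A. f i x)"
    using assms(1) by induction (simp_all add: infsum_add summable_on_add assms(2))
  then show ?thesis ..
qed

lemma Suc_choose_2: "Suc k choose 2 = k + (k choose 2)"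
  by (simp add: numeral_2_eq_2)

context nome
begin

definition qbinom :: "nat \<Rightarrow> nat \<Rightarrow> complex" where
  "qbinom n k = (if k \<le> n then qpoch [q] q n / (qpoch [q] q k * qpoch [q] q (n - k)) else 0)"

lemma qbinom_0 [simp]: "qbinom n 0 = 1"
  by (simp add: qbinom_def qpoch_q_nonzero)

lemma qbinom_self [simp]: "qbinom n n = 1"
  by (simp add: qbinom_def qpoch_q_nonzero)

text \<open>The \<open>q\<close>-Pascal rule; over the common denominator it is
\<open>1 - q\<^bsup>n+1\<^esup> = (1 - q\<^bsup>n-k\<^esup>) + q\<^bsup>n-k\<^esup> (1 - q\<^bsup>k+1\<^esup>)\<close>.\<close>

lemma qbinom_Suc:
  assumes "k \<le> n"
  shows "qbinom (Suc n) (Suc k) = qbinom n (Suc k) + q ^ (n - k) * qbinom n k"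
proof (cases "k = n")
  case True
  then show ?thesis by (simp only: qbinom_self) (simp add: qbinom_def)
next
  case False
  then obtain m where n: "n = Suc (k + m)"
    using assms by (metis add_Suc_right less_imp_Suc_add nless_le)
  have d: "n - k = Suc m" "Suc n - Suc k = Suc m" "n - Suc k = m" by (simp_all add: n)
  have nz: "1 - q * q ^ j \<noteq> 0" for j
    using qpoch_q_nonzero[of "Suc j"] by (simp add: qpoch_Suc)
  let ?N = "qpoch [q] q n" and ?K = "qpoch [q] q k" and ?M = "qpoch [q] q m"
  have "qbinom n (Suc k) + q ^ (n - k) * qbinom n k =
      ?N / (?K * (1 - q * q ^ k) * ?M) + q * q ^ m * (?N / (?K * (?M * (1 - q * q ^ m))))"
    using n by (simp only: qbinom_def d) (simp add: qpoch_Suc)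
  also have "\<dots> = ?N * ((1 - q * q ^ m) + q * q ^ m * (1 - q * q ^ k)) /
      (?K * (1 - q * q ^ k) * (?M * (1 - q * q ^ m)))"
  proof -
    have "N / (K * C * M) + t * (N / (K * (M * D))) = N * (D + t * C) / (K * C * (M * D))"
      if "K \<noteq> 0" "C \<noteq> 0" "M \<noteq> 0" "D \<noteq> 0" for N K C M t D :: complex
      using that by (simp add: field_simps)
    then show ?thesis using nz qpoch_q_nonzero by blast
  qed
  also have "(1 - q * q ^ m) + q * q ^ m * (1 - q * q ^ k) = 1 - q * q ^ n"
    by (simp add: n power_add algebra_simps)
  also have "?N * (1 - q * q ^ n) / (?K * (1 - q * q ^ k) * (?M * (1 - q * q ^ m))) =
      qbinom (Suc n) (Suc k)"
    using assms by (simp only: qbinom_def d) (simp add: qpoch_Suc)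
  finally show ?thesis ..
qed

lemma q_binomial: "qpoch [- x] q n = (\<Sum>k\<le>n. q ^ (k choose 2) * qbinom n k * x ^ k)"
proof (induction n)
  case (Suc n)
  let ?T = "\<lambda>n k. q ^ (k choose 2) * qbinom n k * x ^ k"
  have split: "?T (Suc n) (Suc k) = ?T n (Suc k) + x * q ^ n * ?T n k" if "k \<le> n" for k
  proof -
    have "q ^ n = q ^ k * q ^ (n - k)" using that by (simp flip: power_add)
    then show ?thesis
      unfolding qbinom_Suc[OF that] Suc_choose_2 power_add by (simp add: algebra_simps)
  qed
  have "(\<Sum>k\<le>Suc n. ?T (Suc n) k) = ?T (Suc n) 0 + (\<Sum>k\<le>n. ?T (Suc n) (Suc k))"
    by (rule sum.atMost_Suc_shift)
  also have "(\<Sum>k\<le>n. ?T (Suc n) (Suc k)) = (\<Sum>k\<le>n. ?T n (Suc k)) + x * q ^ n * (\<Sum>k\<le>n. ?T n k)"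
    by (simp add: split sum.distrib sum_distrib_left del: power_Suc)
  also have "?T (Suc n) 0 + ((\<Sum>k\<le>n. ?T n (Suc k)) + x * q ^ n * (\<Sum>k\<le>n. ?T n k)) =
      (?T n 0 + (\<Sum>k\<le>n. ?T n (Suc k))) + x * q ^ n * (\<Sum>k\<le>n. ?T n k)"
    by simp
  also have "?T n 0 + (\<Sum>k\<le>n. ?T n (Suc k)) = (\<Sum>k\<le>Suc n. ?T n k)"
    by (rule sum.atMost_Suc_shift[symmetric])
  also have "\<dots> = (\<Sum>k\<le>n. ?T n k)"
    by (simp add: qbinom_def)
  finally show ?case
    unfolding Suc.IH[symmetric] by (simp add: qpoch_Suc algebra_simps)
qed (simp add: numeral_2_eq_2)

text \<open>Rewrites the coefficients of the terminating basic hypergeometric series for \<open>H\<^sub>n\<close> as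
\<open>q\<close>-binomial coefficients.\<close>

lemma qpoch_neg_power:
  assumes "k \<le> n"
  shows "qpoch [q powi (- int n)] q k / qpoch [q] q k =
    (- 1) ^ k * q ^ (k choose 2) / q ^ (n * k) * qbinom n k"
proof -
  have "qpoch [q powi (- int n)] q k =
    (- 1) ^ k * q ^ (k choose 2) / q ^ (n * k) * (qpoch [q] q n / qpoch [q] q (n - k))"
    using assms
  proof (induction k)
    case 0
    then show ?case by (simp add: qpoch_q_nonzero numeral_2_eq_2)
  next
    case (Suc k)
    define m where "m = n - Suc k"
    have m: "n - k = Suc m" "n - Suc k = m" "n = m + Suc k"
      using Suc.prems by (auto simp: m_def)
    have nz: "1 - q * q ^ m \<noteq> 0"
      using qpoch_q_nonzero[of "Suc m"] by (simp add: qpoch_Suc)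
    have qq: "q ^ n = q ^ k * (q * q ^ m)" unfolding m(3) by (simp add: power_add mult_ac)
    have f: "1 - q powi (- int n) * q ^ k = - (1 - q * q ^ m) * q ^ k / q ^ n"
      unfolding power_int_minus power_int_of_nat qq by (simp add: field_simps)
    have "qpoch [q powi (- int n)] q (Suc k) =
      (- 1) ^ k * q ^ (k choose 2) / q ^ (n * k) * (qpoch [q] q n / (qpoch [q] q m * (1 - q * q ^ m)))
        * (- (1 - q * q ^ m) * q ^ k / q ^ n)"
      using Suc by (simp add: qpoch_Suc f m(1))
    also have "\<dots> = (- 1) ^ Suc k * q ^ (Suc k choose 2) / q ^ (n * Suc k) * (qpoch [q] q n / qpoch [q] q m)"
    proof -
      have exponent: "q ^ (n * Suc k) = q ^ n * q ^ (n * k)" by (simp add: power_add)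
      have "E * C / P * (Q / (M * D)) * (- D * K / N) = - 1 * E * (K * C) / (N * P) * (Q / M)"
        if "D \<noteq> 0" for E C P Q M D K N :: complex
        using that by (simp add: mult_ac)
      from this[OF nz] show ?thesis
        unfolding exponent Suc_choose_2 power_add power_Suc .
    qed
    finally show ?case by (simp only: m(2))
  qed
  then show ?thesis using assms by (simp add: qbinom_def)
qed

text \<open>As a polynomial in \<open>y = z - 1/z\<close>, this is \<open>(z/a, -1/(a z); q)\<^sub>k\<close>: the two factors with index \<open>j\<close>
multiply to \<open>1 - q\<^sup>j y/a - q\<^bsup>2j\<^esup>/a\<^sup>2\<close>.\<close>

definition hermite_basis :: "nat \<Rightarrow> complex \<Rightarrow> complex poly" where
  "hermite_basis k a = (\<Prod>j<k. [:1 - q ^ (2 * j) / a\<^sup>2, - (q ^ j / a):])"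

text \<open>The explicit formula for \<open>H\<^sub>n\<close> after \<open>(q\<^bsup>-n\<^esup>; q)\<^sub>k\<close> has been expressed by a \<open>q\<close>-binomial
coefficient, which cancels the powers of \<open>q\<^sup>n\<close>.\<close>

definition hermite_poly :: "nat \<Rightarrow> complex \<Rightarrow> complex poly" where
  "hermite_poly n a = smult ((- (1 / a)) ^ n)
     (\<Sum>k\<le>n. smult (qbinom n k * a ^ (2 * k) / q ^ (k choose 2)) (hermite_basis k a))"

lemma hermite_basis_Suc:
  "hermite_basis (Suc k) a = hermite_basis k a * [:1 - q ^ (2 * k) / a\<^sup>2, - (q ^ k / a):]"
  by (simp only: hermite_basis_def prod.lessThan_Suc mult.commute)

lemma poly_hermite_basis:
  assumes "a \<noteq> 0" "z \<noteq> 0"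
  shows "poly (hermite_basis k a) (z - 1 / z) = qpoch [z / a, - (1 / (a * z))] q k"
proof (induction k)
  case 0
  then show ?case by (simp add: hermite_basis_def)
next
  case (Suc k)
  have "poly (hermite_basis (Suc k) a) (z - 1 / z) =
    poly (hermite_basis k a) (z - 1 / z) * ((1 - z / a * q ^ k) * (1 - - (1 / (a * z)) * q ^ k))"
  proof -
    have "poly [:1 - q ^ (2 * k) / a\<^sup>2, - (q ^ k / a):] (z - 1 / z) =
        (1 - z / a * q ^ k) * (1 - - (1 / (a * z)) * q ^ k)"
      using assms by (simp add: field_simps power2_eq_square power_mult)
    then show ?thesis by (simp only: hermite_basis_Suc poly_mult)
  qed
  then show ?case by (simp only: Suc.IH qpoch_Cons[of _ "[_]"] qpoch_Suc) (simp only: mult_ac)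
qed

lemma big_qinv_Hermite_eq_poly:
  assumes "a \<noteq> 0" "z \<noteq> 0"
  shows "big_qinv_Hermite n z a q = poly (hermite_poly n a) (z - 1 / z)"
proof -
  have terms: "qpoch [q powi (- int n), z / a, - (1 / (a * z))] q k / qpoch [q] q k
        * q powi (- 2 * int (k choose 2)) * (- (q ^ n) * a\<^sup>2) ^ k =
      qbinom n k * a ^ (2 * k) / q ^ (k choose 2) * poly (hermite_basis k a) (z - 1 / z)" if "k \<le> n" for k
  proof -
    have 1: "q powi (- 2 * int (k choose 2)) = 1 / (q ^ (k choose 2) * q ^ (k choose 2))"
    proof -
      have "- 2 * int (k choose 2) = - int (2 * (k choose 2))" by simp
      then have "q powi (- 2 * int (k choose 2)) = inverse (q ^ (2 * (k choose 2)))"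
        by (simp only: power_int_minus power_int_of_nat)
      then show ?thesis by (simp only: mult_2 power_add inverse_eq_divide)
    qed
    have 2: "(- (q ^ n) * a\<^sup>2) ^ k = (- 1) ^ k * q ^ (n * k) * a ^ (2 * k)"
      unfolding power_mult power_mult_distrib[symmetric] by simp
    have 3: "qpoch [q powi (- int n), z / a, - (1 / (a * z))] q k / qpoch [q] q k =
      (- 1) ^ k * q ^ (k choose 2) / q ^ (n * k) * qbinom n k * poly (hermite_basis k a) (z - 1 / z)"
      unfolding poly_hermite_basis[OF assms] qpoch_Cons[of _ "[_, _]"] times_divide_eq_left[symmetric]
        qpoch_neg_power[OF that] ..
    have sign: "(- 1 :: complex) ^ k * (- 1) ^ k = 1" by (simp flip: power_mult_distrib)
    have "e * C / N * b * p * (1 / (C * C)) * (e * N * A) = (e * e) * (b * A / C * p)"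
      if "C \<noteq> 0" "N \<noteq> 0" for e C N b p A :: complex
      using that by simp
    note key = this[where e = "(- 1) ^ k" and C = "q ^ (k choose 2)" and N = "q ^ (n * k)"]
    show ?thesis
      unfolding 1 2 3 by (subst key) (simp_all add: sign)
  qed
  show ?thesis
    unfolding big_qinv_Hermite_explicit[OF q_nonzero assms] hermite_poly_def poly_smult poly_sum
      atLeast0AtMost by (intro arg_cong[where f = "(*) _"] sum.cong refl terms) simp
qed

lemma hermite_basis_degree: "degree (hermite_basis k a) \<le> k"
proof -
  have "degree (hermite_basis k a) \<le> (\<Sum>j<k. degree [:1 - q ^ (2 * j) / a\<^sup>2, - (q ^ j / a):])"
    unfolding hermite_basis_def by (rule order_trans[OF degree_prod_sum_le]) (simp_all add: o_def)
  also have "\<dots> \<le> (\<Sum>j<k. 1)" by (rule sum_mono) simp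
  finally show ?thesis by simp
qed

lemma hermite_basis_coeff: "coeff (hermite_basis k a) k = (- (1 / a)) ^ k * q ^ (k choose 2)"
proof (induction k)
  case 0
  then show ?case by (simp add: hermite_basis_def numeral_2_eq_2)
next
  case (Suc k)
  have "hermite_basis (Suc k) a = hermite_basis k a * [:1 - q ^ (2 * k) / a\<^sup>2, - (q ^ k / a):]"
    by (rule hermite_basis_Suc)
  then have "coeff (hermite_basis (Suc k) a) (Suc k) =
      coeff (hermite_basis k a) (Suc k) * (1 - q ^ (2 * k) / a\<^sup>2) + coeff (hermite_basis k a) k * (- (q ^ k / a))"
    by (simp add: mult.commute)
  moreover have "coeff (hermite_basis k a) (Suc k) = 0"
    by (rule coeff_eq_0) (use hermite_basis_degree[of k a] in simp)
  ultimately show ?case unfolding Suc.IH Suc_choose_2 by (simp add: power_add)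
qed

lemma hermite_poly_degree: "degree (hermite_poly n a) \<le> n"
  unfolding hermite_poly_def
  by (intro order_trans[OF degree_smult_le] degree_sum_le)
     (auto intro: order_trans[OF degree_smult_le] order_trans[OF hermite_basis_degree])

lemma hermite_poly_coeff:
  assumes "a \<noteq> 0"
  shows "coeff (hermite_poly n a) n = 1"
proof -
  have "coeff (hermite_basis k a) n = 0" if "k < n" for k
    by (rule coeff_eq_0) (use hermite_basis_degree[of k a] that in simp)
  then have "(\<Sum>k\<le>n. qbinom n k * a ^ (2 * k) / q ^ (k choose 2) * coeff (hermite_basis k a) n) =
      (\<Sum>k\<le>n. if k = n then qbinom n n * a ^ (2 * n) / q ^ (n choose 2) * coeff (hermite_basis n a) n else 0)"
    by (intro sum.cong) auto
  also have "\<dots> = (- a) ^ n"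
  proof -
    have "a ^ (2 * n) * (- (1 / a)) ^ n = (- a) ^ n"
      unfolding power_mult power_mult_distrib[symmetric] using assms by (simp add: power2_eq_square)
    then show ?thesis by (simp add: hermite_basis_coeff)
  qed
  finally have "coeff (hermite_poly n a) n = (- (1 / a)) ^ n * (- a) ^ n"
    by (simp add: hermite_poly_def coeff_sum)
  also have "\<dots> = 1"
    unfolding power_mult_distrib[symmetric] using assms by simp
  finally show ?thesis .
qed

text \<open>The basis polynomials are, up to constants, the quotients of weights whose parameters differ
by a power of \<open>q\<close>.\<close>

lemma weight_divide_q_power:
  assumes "a \<noteq> 0" "z \<noteq> 0"
  shows "weight (a / q ^ k) z =
    (- 1) ^ k * a ^ (2 * k) / (q ^ (k choose 2)) ^ 2 * poly (hermite_basis k a) (z - 1 / z) * weight a z"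
proof (induction k)
  case 0
  then show ?case by (simp add: hermite_basis_def numeral_2_eq_2)
next
  case (Suc k)
  let ?y = "z - 1 / z"
  have e: "1 + a / q ^ k * ?y - (a / q ^ k)\<^sup>2 =
      - (a\<^sup>2) / (q ^ k)\<^sup>2 * poly [:1 - q ^ (2 * k) / a\<^sup>2, - (q ^ k / a):] y" if "y = ?y" for y
    unfolding that[symmetric] using assms by (simp add: field_simps power2_eq_square power_mult)
  have "weight (a / q ^ Suc k) z = weight (a / q ^ k / q) z"
    by (simp add: mult.commute)
  also have "\<dots> = (1 + a / q ^ k * ?y - (a / q ^ k)\<^sup>2) * weight (a / q ^ k) z"
    by (rule weight_divide_q[OF assms(2)])
  also have "\<dots> = (- 1) ^ Suc k * a ^ (2 * Suc k) / (q ^ (Suc k choose 2)) ^ 2 *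
      (poly (hermite_basis k a) ?y * poly [:1 - q ^ (2 * k) / a\<^sup>2, - (q ^ k / a):] ?y) * weight a z"
    unfolding e[OF refl] Suc.IH Suc_choose_2
    by (simp add: power_add power_mult_distrib power2_eq_square mult_ac del: poly_pCons)
  also have "poly (hermite_basis k a) ?y * poly [:1 - q ^ (2 * k) / a\<^sup>2, - (q ^ k / a):] ?y = poly (hermite_basis (Suc k) a) ?y"
    by (simp only: hermite_basis_Suc poly_mult)
  finally show ?case .
qed

text \<open>Multiplying by \<open>H\<^sub>n\<close> is an \<open>n\<close>-th order \<open>q\<close>-difference in the parameter of the weight.\<close>

lemma hermite_weight:
  assumes "a \<noteq> 0" "z \<noteq> 0"
  shows "poly (hermite_poly n a) (z - 1 / z) * weight a z =
    (- (1 / a)) ^ n * (\<Sum>k\<le>n. q ^ (k choose 2) * qbinom n k * (- 1) ^ k * weight (a / q ^ k) z)"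
proof -
  have "q ^ (k choose 2) * qbinom n k * (- 1) ^ k * weight (a / q ^ k) z =
      qbinom n k * a ^ (2 * k) / q ^ (k choose 2) * poly (hermite_basis k a) (z - 1 / z) * weight a z" for k
  proof -
    have "(- 1 :: complex) ^ k * (- 1) ^ k = 1" by (simp flip: power_mult_distrib)
    moreover have "C * b * e * (e * A / C\<^sup>2 * p * w) = (e * e) * (b * A / C * p * w)"
      if "C \<noteq> 0" for A C b e p w :: complex
      using that by (simp add: power2_eq_square)
    ultimately show ?thesis
      unfolding weight_divide_q_power[OF assms] by simp
  qed
  then show ?thesis
    by (simp add: hermite_poly_def poly_sum sum_distrib_right)
qed

lemma qpoch_neg_power_eq_0: "j < n \<Longrightarrow> qpoch [q powi (- int j)] q n = 0"
proof -
  assume "j < n"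
  have "1 - q powi (- int j) * q ^ j = 0" by (simp add: power_int_minus)
  then show ?thesis using \<open>j < n\<close> by (auto simp: qpoch_def)
qed

text \<open>The sum with \<open>H\<^sub>n\<close> is a \<open>q\<close>-difference of the polynomial in \<open>a\<close> that describes the sum without it.
On the monomial \<open>a\<^sup>j\<close> that difference is \<open>(q\<^bsup>-j\<^esup>; q)\<^sub>n\<close> by the \<open>q\<close>-binomial theorem, which vanishes
for \<open>j < n\<close>, so only the top coefficient survives.\<close>

lemma bisum_hermite_poly:
  assumes \<beta>: "\<beta> \<noteq> 0" and a: "a \<noteq> 0" and p: "degree p \<le> n"
  shows "bisum (\<lambda>z. (1 + z\<^sup>2) * poly p (z - 1 / z) * poly (hermite_poly n a) (z - 1 / z)) a \<beta> =
    bisum (\<lambda>z. 1 + z\<^sup>2) 0 \<beta> * (coeff p n * (qpoch [q] q n / (q ^ (n choose 2) * q ^ n)))"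
proof -
  let ?f = "\<lambda>z. (1 + z\<^sup>2) * poly p (z - 1 / z)"
  let ?\<mu> = "bisum (\<lambda>z. 1 + z\<^sup>2) 0 \<beta>"
  define c where "c k = (- (1 / a)) ^ n * (q ^ (k choose 2) * qbinom n k * (- 1) ^ k)" for k
  have f: "moderate ?f" by auto
  have qb: "qpoch [q powi (- int j)] q n =
      (\<Sum>k\<le>n. q ^ (k choose 2) * qbinom n k * (- (q powi (- int j))) ^ k)" for j
    using q_binomial[of "- (q powi (- int j))" n] by simp
  obtain P where P: "degree P \<le> n" "coeff P n = coeff p n"
    "\<And>a. a \<noteq> 0 \<Longrightarrow> bisum ?f a \<beta> = ?\<mu> * poly P a"
    using bisum_poly[OF \<beta> p] by blast
  have "summand (\<lambda>z. ?f z * poly (hermite_poly n a) (z - 1 / z)) a \<beta> j =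
      (\<Sum>k\<le>n. c k * summand ?f (a / q ^ k) \<beta> j)" for j
  proof -
    define z where "z = q powi j * \<beta>"
    have z: "z \<noteq> 0" using \<beta> by (simp add: z_def)
    have "summand (\<lambda>z. ?f z * poly (hermite_poly n a) (z - 1 / z)) a \<beta> j =
        ?f z * (poly (hermite_poly n a) (z - 1 / z) * weight a z) * lattice_gauss \<beta> j"
      by (simp only: summand_def z_def mult.assoc)
    also have "\<dots> = (\<Sum>k\<le>n. c k * (?f z * weight (a / q ^ k) z * lattice_gauss \<beta> j))"
      unfolding hermite_weight[OF a z] c_def sum_distrib_left sum_distrib_right by (simp only: mult_ac)
    finally show ?thesis by (simp only: summand_def z_def)
  qed
  then have "bisum (\<lambda>z. ?f z * poly (hermite_poly n a) (z - 1 / z)) a \<beta> =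
      (\<Sum>\<^sub>\<infinity>j. \<Sum>k\<le>n. c k * summand ?f (a / q ^ k) \<beta> j)"
    by (simp add: bisum_def)
  also have "\<dots> = (\<Sum>k\<le>n. \<Sum>\<^sub>\<infinity>j. c k * summand ?f (a / q ^ k) \<beta> j)"
    by (rule infsum_finite_sum) (intro finite_atMost summable_on_cmult_right summable_summand f \<beta>)+
  also have "\<dots> = (\<Sum>k\<le>n. c k * (?\<mu> * poly P (a / q ^ k)))"
    using P(3) a by (simp add: infsum_cmult_right' bisum_def)
  also have "\<dots> = (\<Sum>k\<le>n. \<Sum>j\<le>n. ?\<mu> * (- (1 / a)) ^ n * coeff P j * a ^ j *
      (q ^ (k choose 2) * qbinom n k * (- (q powi (- int j))) ^ k))"
  proof (rule sum.cong[OF refl])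
    fix k
    have "poly P x = (\<Sum>j\<le>n. coeff P j * x ^ j)" for x
      unfolding poly_altdef
      by (rule sum.mono_neutral_left) (use P(1) in \<open>auto intro: coeff_eq_0\<close>)
    moreover have "(a / q ^ k) ^ j * (- 1) ^ k = a ^ j * (- (q powi (- int j))) ^ k" for j
    proof -
      have "(q ^ k) ^ j = (q ^ j) ^ k" by (simp only: mult.commute flip: power_mult)
      then show ?thesis
        unfolding power_int_minus power_int_of_nat power_divide power_minus[of "inverse _"] power_inverse
        by (simp add: divide_inverse)
    qed
    ultimately show "c k * (?\<mu> * poly P (a / q ^ k)) = (\<Sum>j\<le>n. ?\<mu> * (- (1 / a)) ^ n * coeff P j * a ^ j *
      (q ^ (k choose 2) * qbinom n k * (- (q powi (- int j))) ^ k))"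
    proof -
      assume eval: "\<And>x. poly P x = (\<Sum>j\<le>n. coeff P j * x ^ j)"
      assume pow: "\<And>j. (a / q ^ k) ^ j * (- 1) ^ k = a ^ j * (- (q powi (- int j))) ^ k"
      have "L * (Q * b * e) * (M * (p * y)) = M * L * p * w * (Q * b * x)" if "y * e = w * x"
        for L Q b e M p y w x :: complex
      proof -
        have "L * (Q * b * e) * (M * (p * y)) = M * L * p * (Q * b) * (y * e)"
          by (simp only: mult_ac)
        also have "\<dots> = M * L * p * w * (Q * b * x)"
          unfolding that by (simp only: mult_ac)
        finally show ?thesis .
      qed
      note key = this[OF pow]
      show ?thesis
        unfolding eval c_def sum_distrib_left by (intro sum.cong refl key)
    qed
  qed
  also have "\<dots> = (\<Sum>j\<le>n. ?\<mu> * (- (1 / a)) ^ n * coeff P j * a ^ j * qpoch [q powi (- int j)] q n)"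
    by (subst sum.swap) (simp only: qb sum_distrib_left)
  also have "\<dots> = (\<Sum>j\<le>n. if j = n then ?\<mu> * (- (1 / a)) ^ n * coeff P n * a ^ n * qpoch [q powi (- int n)] q n else 0)"
    by (rule sum.cong) (auto simp: qpoch_neg_power_eq_0)
  also have "\<dots> = ?\<mu> * (coeff p n * ((- 1) ^ n * qpoch [q powi (- int n)] q n))"
  proof -
    have "(- (1 / a)) ^ n * a ^ n = (- 1) ^ n"
      unfolding power_mult_distrib[symmetric] using a by simp
    then show ?thesis using P(2) by (simp add: mult_ac)
  qed
  also have "(- 1) ^ n * qpoch [q powi (- int n)] q n = qpoch [q] q n / (q ^ (n choose 2) * q ^ n)"
  proof -
    have "n * n = (n choose 2) + (n choose 2) + n"
      by (induction n) (simp_all add: Suc_choose_2 numeral_2_eq_2)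
    then have "q ^ (n * n) = q ^ (n choose 2) * (q ^ (n choose 2) * q ^ n)"
      by (simp add: power_add)
    moreover have "qpoch [q powi (- int n)] q n = (- 1) ^ n * q ^ (n choose 2) / q ^ (n * n) * qpoch [q] q n"
      using qpoch_neg_power[of n n] qpoch_q_nonzero[of n] by (simp add: divide_eq_eq)
    moreover have "(- 1 :: complex) ^ n * (- 1) ^ n = 1" by (simp flip: power_mult_distrib)
    ultimately show ?thesis by (simp flip: mult.assoc)
  qed
  finally show ?thesis .
qed

lemma Psi_term_eq:
  "\<beta> \<noteq> 0 \<Longrightarrow> a \<noteq> 0 \<Longrightarrow> Psi_term m n \<beta> a q k =
    summand (\<lambda>z. (1 + z\<^sup>2) * poly (hermite_poly m a) (z - 1 / z) * poly (hermite_poly n a) (z - 1 / z)) a \<beta> k"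
proof -
  assume nz: "\<beta> \<noteq> 0" "a \<noteq> 0"
  define z where "z = q powi k * \<beta>"
  have z: "z \<noteq> 0" using nz by (simp add: z_def)
  have "q powi (2 * k) = (q powi k)\<^sup>2"
    by (subst mult.commute) (simp add: power_int_mult)
  then have 1: "q powi (2 * k) * \<beta>\<^sup>2 = z\<^sup>2"
    by (simp add: z_def power_mult_distrib)
  have 2: "[- (q powi (k + 1)) * \<beta> * a, q powi (1 - k) * a / \<beta>] = [- (q * a * z), q * a / z]"
    by (simp add: z_def power_int_add power_int_diff)
  show ?thesis
    unfolding Psi_term_def summand_def 1 2 z_def[symmetric] big_qinv_Hermite_eq_poly[OF nz(2) z] weight_def lattice_gauss_def
    by (simp only: mult_ac)
qed

lemma Psi_eq:
  assumes "\<beta> \<noteq> 0" "a \<noteq> 0"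
  shows "Psi m n \<beta> a q = bisum (\<lambda>z. 1 + z\<^sup>2) 0 \<beta> *
    ((if m = n then 1 else 0) * (qpoch [q] q n / (q ^ (n choose 2) * q ^ n)))"
proof -
  have main: "Psi m n \<beta> a q = bisum (\<lambda>z. 1 + z\<^sup>2) 0 \<beta> *
    ((if m = n then 1 else 0) * (qpoch [q] q n / (q ^ (n choose 2) * q ^ n)))" if "m \<le> n" for m n
  proof -
    have "coeff (hermite_poly m a) n = (if m = n then 1 else 0)"
      using that hermite_poly_coeff[OF assms(2)] hermite_poly_degree[of m a] by (auto intro: coeff_eq_0)
    moreover have "degree (hermite_poly m a) \<le> n"
      using hermite_poly_degree that by (rule order_trans)
    ultimately show ?thesis
      using bisum_hermite_poly[OF assms, of "hermite_poly m a" n]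
      by (simp add: Psi_def Psi_term_eq[OF assms] bisum_def)
  qed
  show ?thesis
  proof (cases "m \<le> n")
    case False
    have "Psi m n \<beta> a q = Psi n m \<beta> a q"
      unfolding Psi_def Psi_term_def by (simp only: mult_ac)
    then show ?thesis using main[of n m] False by simp
  qed (rule main)
qed

end

section \<open>Jacobi's triple product identity\<close>

text \<open>Extends \<open>k choose 2\<close> to negative \<open>k\<close>.\<close>

definition triangle :: "int \<Rightarrow> int" where "triangle k = k * (k - 1) div 2"

lemma two_triangle: "2 * triangle k = k * (k - 1)"
  unfolding triangle_def by (rule dvd_mult_div_cancel) auto

lemma triangle_of_nat: "triangle (int i) = int (i choose 2)"
proof (induction i)
  case 0
  then show ?case by (simp add: triangle_def numeral_2_eq_2)
next
  case (Suc i)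
  have "2 * triangle (int (Suc i)) = 2 * (triangle (int i) + int i)"
    unfolding distrib_left two_triangle by (simp add: algebra_simps)
  then show ?case using Suc.IH by (simp add: Suc_choose_2)
qed

context nome
begin

lemma qpoch_add: "qpoch [y] q (m + n) = qpoch [y] q m * qpoch [q ^ m * y] q n"
  by (induction n) (simp_all add: qpoch_Suc power_add mult_ac)

lemma qpoch_reflect:
  assumes "x \<noteq> 0"
  shows "qpoch [- (x / q ^ N)] q N = x ^ N / q ^ (Suc N choose 2) * qpoch [- q / x] q N"
proof (induction N)
  case 0
  then show ?case by (simp add: numeral_2_eq_2)
next
  case (Suc N)
  have "qpoch [- (x / q ^ Suc N)] q (Suc N) = (1 + x / q ^ Suc N) * qpoch [- (x / q ^ N)] q N"
    unfolding qpoch_Suc_shift by simp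
  also have "1 + x / q ^ Suc N = x / q ^ Suc N * (1 + q / x * q ^ N)"
    using assms by (simp add: field_simps)
  finally show ?case
    unfolding Suc.IH Suc_choose_2[of "Suc N"] power_add qpoch_Suc by simp
qed

text \<open>The \<open>q\<close>-binomial theorem with \<open>2N\<close> factors, starting from the argument \<open>x/q\<^sup>N\<close>. Its first \<open>N\<close> factors
are the reflected product in \<open>1/x\<close> up to a monomial, and the summation index is
centred at \<open>N\<close>.\<close>

lemma finite_triple_product:
  assumes "x \<noteq> 0"
  shows "qpoch [- x] q N * qpoch [- q / x] q N =
    (\<Sum>k = - int N..int N. q powi triangle k * x powi k * qbinom (2 * N) (nat (int N + k)))"
proof -
  have "x ^ N / q ^ (Suc N choose 2) * (qpoch [- x] q N * qpoch [- q / x] q N) =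
      qpoch [- (x / q ^ N)] q (2 * N)"
    unfolding mult_2 qpoch_add qpoch_reflect[OF assms] by simp
  also have "\<dots> = (\<Sum>i\<le>2 * N. q ^ (i choose 2) * qbinom (2 * N) i * (x / q ^ N) ^ i)"
    by (rule q_binomial)
  also have "\<dots> = (\<Sum>k = - int N..int N. x ^ N / q ^ (Suc N choose 2) *
      (q powi triangle k * x powi k * qbinom (2 * N) (nat (int N + k))))"
  proof (rule sum.reindex_bij_witness[where i = "\<lambda>k. nat (int N + k)" and j = "\<lambda>i. int i - int N"])
    fix i assume "i \<in> {..2 * N}"
    have "2 * (triangle (int i - int N) + int (N * i)) = 2 * (int (i choose 2) + int (Suc N choose 2))"
      unfolding distrib_left triangle_of_nat[symmetric] two_triangle by (simp add: algebra_simps)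
    then have "triangle (int i - int N) + int (N * i) = int (i choose 2) + int (Suc N choose 2)"
      by (metis mult_cancel_left zero_neq_numeral)
    then have "triangle (int i - int N) = int (i choose 2) + int (Suc N choose 2) - int (N * i)"
      by (simp only: eq_diff_eq)
    then have "q powi triangle (int i - int N) = q ^ (i choose 2) * q ^ (Suc N choose 2) / q ^ (N * i)"
      by (simp only: power_int_add power_int_diff power_int_of_nat q_nonzero not_False_eq_True disj_not1 simp_thms)
    moreover have "x powi (int i - int N) = x ^ i / x ^ N"
      using assms by (simp add: power_int_diff)
    ultimately show "x ^ N / q ^ (Suc N choose 2) * (q powi triangle (int i - int N) * x powi (int i - int N) *
        qbinom (2 * N) (nat (int N + (int i - int N)))) = q ^ (i choose 2) * qbinom (2 * N) i * (x / q ^ N) ^ i"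
      using assms by (simp add: power_divide flip: power_mult)
  qed auto
  also have "\<dots> = x ^ N / q ^ (Suc N choose 2) *
      (\<Sum>k = - int N..int N. q powi triangle k * x powi k * qbinom (2 * N) (nat (int N + k)))"
    by (rule sum_distrib_left[symmetric])
  finally show ?thesis
    using assms by (simp only: mult_cancel_left divide_eq_0_iff power_eq_0_iff q_nonzero simp_thms)
qed

text \<open>Because the exponent is \<open>k(k-1)/2\<close>, the majorant has base \<open>sqrt |q|\<close> instead of \<open>|q|\<close>.\<close>

lemma theta_term_bound:
  assumes "x \<noteq> 0"
  obtains D s where "0 \<le> D" "0 \<le> s" "s < 1"
    "\<And>k. norm (q powi triangle k * x powi k) \<le> D ^ nat \<bar>k\<bar> * s ^ (nat \<bar>k\<bar>)\<^sup>2"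
proof -
  define s where "s = sqrt (norm q)"
  have s: "0 < s" "s < 1" "s ^ 2 = norm q"
    using norm_q_pos norm_q_less_1 by (auto simp: s_def)
  define X where "X = max (norm x) (1 / norm x)"
  have X: "norm x \<le> X" "1 / norm x \<le> X" by (auto simp: X_def)
  have X0: "0 \<le> X" using norm_ge_zero X(1) by (rule order_trans)
  show thesis
  proof (rule that[of "X / s" s])
    fix k :: int
    define n where "n = nat \<bar>k\<bar>"
    have sp: "norm q powi triangle k = s powi (k * k - k)"
    proof -
      have "norm q powi triangle k = (s ^ 2) powi triangle k" by (simp add: s)
      also have "\<dots> = s powi (2 * triangle k)" by (simp add: power_int_mult)
      finally show ?thesis by (simp add: two_triangle right_diff_distrib)
    qed
    have "s powi (k * k - k) \<le> s ^ n\<^sup>2 / s ^ n \<and> norm x powi k \<le> X ^ n"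
    proof (cases "0 \<le> k")
      case True
      then have k: "k = int n" by (simp add: n_def)
      have "s powi (k * k - k) = s ^ n\<^sup>2 / s ^ n"
        using s by (simp add: k power_int_diff power2_eq_square flip: of_nat_mult)
      then show ?thesis using X by (simp add: k power_mono)
    next
      case False
      then have k: "k = - int n" by (simp add: n_def)
      have "s powi (k * k - k) = s powi int (n * n + n)" by (simp add: k)
      then have "s powi (k * k - k) = s ^ (n\<^sup>2 + n)" by (simp only: power_int_of_nat power2_eq_square)
      also have "\<dots> \<le> s ^ n\<^sup>2 / 1" using s by (simp add: power_decreasing)
      also have "\<dots> \<le> s ^ n\<^sup>2 / s ^ n" using s by (intro divide_left_mono) (auto intro: power_le_one)
      finally have 1: "s powi (k * k - k) \<le> s ^ n\<^sup>2 / s ^ n" .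
      have "norm x powi k = (1 / norm x) ^ n"
        by (simp add: k power_int_minus power_one_over inverse_eq_divide)
      then show ?thesis using X 1 by (simp add: power_mono)
    qed
    then have "norm (q powi triangle k) * norm (x powi k) \<le> (s ^ n\<^sup>2 / s ^ n) * X ^ n"
      unfolding norm_power_int sp using s X0 by (intro mult_mono) auto
    then show "norm (q powi triangle k * x powi k) \<le> (X / s) ^ nat \<bar>k\<bar> * s ^ (nat \<bar>k\<bar>)\<^sup>2"
      by (simp add: norm_mult power_divide n_def mult_ac)
  qed (use s X0 in auto)
qed

lemma summable_theta:
  assumes "x \<noteq> 0"
  shows "(\<lambda>k. q powi triangle k * x powi k) summable_on UNIV"
proof -
  obtain D s where Ds: "0 \<le> D" "0 \<le> s" "s < 1"
    "\<And>k. norm (q powi triangle k * x powi k) \<le> D ^ nat \<bar>k\<bar> * s ^ (nat \<bar>k\<bar>)\<^sup>2"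
    using theta_term_bound[OF assms] by blast
  have "(\<lambda>k. norm (q powi triangle k * x powi k)) summable_on UNIV"
    by (rule summable_on_comparison_test[OF summable_theta_majorant[OF Ds(2,3) zero_le_one Ds(1)]])
       (use Ds(4) in auto)
  then show ?thesis by (rule abs_summable_summable)
qed

text \<open>The limit \<open>N \<rightarrow> \<infinity>\<close> of the finite identity. The central \<open>q\<close>-binomial coefficients are
bounded, since \<open>(q; q)\<^sub>n\<close> and its inverse both converge, and they tend to \<open>1/(q; q)\<^sub>\<infinity>\<close>.\<close>

lemma triple_product:
  assumes x: "x \<noteq> 0"
  shows "(\<Sum>\<^sub>\<infinity>k. q powi triangle k * x powi k) = qpoch_inf [q] q * (qpoch_inf [- x] q * qpoch_inf [- q / x] q)"
proof -
  let ?g = "\<lambda>k. q powi triangle k * x powi k"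
  let ?I = "qpoch_inf [q] q"
  have I: "?I \<noteq> 0" by (rule qpoch_inf_nonzero[OF norm_q_less_1])
  \<comment> \<open>The finite sums are extended by \<open>0\<close> to all integers.\<close>
  define f where "f N k = (if k \<in> {- int N..int N} then ?g k * qbinom (2 * N) (nat (int N + k)) else 0)" for N k
  obtain D s where Ds: "0 \<le> D" "0 \<le> s" "s < 1"
    "\<And>k. norm (?g k) \<le> D ^ nat \<bar>k\<bar> * s ^ (nat \<bar>k\<bar>)\<^sup>2"
    using theta_term_bound[OF x] by blast
  have lim_inv: "(\<lambda>n. inverse (qpoch [q] q n)) \<longlonglongrightarrow> inverse ?I"
    by (intro tendsto_inverse qpoch_LIMSEQ I)
  then obtain K where K: "\<And>n. norm (inverse (qpoch [q] q n)) \<le> K"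
    using convergent_imp_Bseq[OF convergentI[OF lim_inv]] by (auto simp: Bseq_def)
  define E where "E = exp (norm q / (1 - norm q))"
  have K0: "0 \<le> K" using norm_ge_zero K by (rule order_trans)
  have binom_bound: "norm (qbinom n k) \<le> E * (K * K)" for n k
  proof (cases "k \<le> n")
    case True
    then have "norm (qbinom n k) = norm (qpoch [q] q n) *
        (norm (inverse (qpoch [q] q k)) * norm (inverse (qpoch [q] q (n - k))))"
      by (simp add: qbinom_def norm_mult norm_divide norm_inverse divide_simps)
    also have "\<dots> \<le> E * (K * K)"
      unfolding E_def using K K0 by (intro mult_mono norm_qpoch_le) auto
    finally show ?thesis .
  next
    case False
    then show ?thesis using K0 by (simp add: qbinom_def E_def)
  qed
  have "(\<lambda>N. \<Sum>\<^sub>\<infinity>k. f N k) \<longlonglongrightarrow> (\<Sum>\<^sub>\<infinity>k. ?g k * inverse ?I)"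
  proof (rule tendsto_infsum_dominated[OF _ _ summable_theta_majorant[OF Ds(2,3) _ Ds(1)]])
    show EK: "0 \<le> E * (K * K)" using K0 by (simp add: E_def)
    show "norm (f N k) \<le> E * (K * K) * D ^ nat \<bar>k\<bar> * s ^ (nat \<bar>k\<bar>)\<^sup>2" for N k
    proof (cases "k \<in> {- int N..int N}")
      case True
      then have "norm (f N k) = norm (?g k) * norm (qbinom (2 * N) (nat (int N + k)))"
        by (simp add: f_def norm_mult)
      also have "\<dots> \<le> (D ^ nat \<bar>k\<bar> * s ^ (nat \<bar>k\<bar>)\<^sup>2) * (E * (K * K))"
        using Ds by (intro mult_mono binom_bound Ds(4)) auto
      finally show ?thesis by (simp only: mult_ac)
    next
      case False
      then show ?thesis using EK Ds by (auto simp: f_def)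
    qed
    fix k
    have "eventually (\<lambda>N. nat \<bar>k\<bar> \<le> N) sequentially" by (rule eventually_ge_at_top)
    then have ev: "eventually (\<lambda>N. ?g k * (qpoch [q] q (2 * N) *
        (inverse (qpoch [q] q (nat (int N + k))) * inverse (qpoch [q] q (nat (int N - k))))) = f N k) sequentially"
    proof eventually_elim
      case (elim N)
      then have "k \<in> {- int N..int N}" "nat (int N + k) \<le> 2 * N" "2 * N - nat (int N + k) = nat (int N - k)"
        by auto
      then show ?case by (simp add: f_def qbinom_def divide_inverse)
    qed
    have inf: "filterlim (\<lambda>N. nat (int N + j)) sequentially sequentially" for j
      unfolding filterlim_at_top
    proof
      fix M
      show "eventually (\<lambda>N. M \<le> nat (int N + j)) sequentially"
        using eventually_ge_at_top[of "M + nat \<bar>j\<bar>"] by eventually_elim auto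
    qed
    have L: "(\<lambda>N. ?g k * (qpoch [q] q (2 * N) *
        (inverse (qpoch [q] q (nat (int N + k))) * inverse (qpoch [q] q (nat (int N + - k))))))
        \<longlonglongrightarrow> ?g k * (?I * (inverse ?I * inverse ?I))"
      by (intro tendsto_mult tendsto_const filterlim_compose[OF lim_inv inf]
            filterlim_compose[OF qpoch_LIMSEQ] filterlim_subseq strict_monoI) auto
    have "?g k * (?I * (inverse ?I * inverse ?I)) = ?g k * inverse ?I"
      using I by simp
    from L[unfolded this add_uminus_conv_diff] show "(\<lambda>N. f N k) \<longlonglongrightarrow> ?g k * inverse ?I"
      by (rule Lim_transform_eventually[OF _ ev])
  qed
  moreover have "(\<Sum>\<^sub>\<infinity>k. f N k) = qpoch [- x] q N * qpoch [- q / x] q N" for N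
  proof -
    have "(\<Sum>\<^sub>\<infinity>k. f N k) = (\<Sum>\<^sub>\<infinity>k\<in>{- int N..int N}. f N k)"
      by (rule infsum_cong_neutral) (auto simp: f_def)
    also have "\<dots> = (\<Sum>k = - int N..int N. ?g k * qbinom (2 * N) (nat (int N + k)))"
      by (simp add: f_def)
    also have "\<dots> = qpoch [- x] q N * qpoch [- q / x] q N"
      by (rule finite_triple_product[OF x, symmetric])
    finally show ?thesis .
  qed
  moreover have "(\<lambda>N. qpoch [- x] q N * qpoch [- q / x] q N) \<longlonglongrightarrow> qpoch_inf [- x] q * qpoch_inf [- q / x] q"
    by (intro tendsto_mult qpoch_LIMSEQ)
  ultimately have "(\<Sum>\<^sub>\<infinity>k. ?g k * inverse ?I) = qpoch_inf [- x] q * qpoch_inf [- q / x] q"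
    using LIMSEQ_unique by auto
  then have "(\<Sum>\<^sub>\<infinity>k. ?g k) * inverse ?I = qpoch_inf [- x] q * qpoch_inf [- q / x] q"
    by (simp only: infsum_cmult_left')
  moreover have "s = i * r" if "s * inverse i = r" "i \<noteq> 0" for s i r :: complex
    using that by (auto simp: field_simps)
  ultimately show ?thesis using I by blast
qed

text \<open>The two summands of \<open>1 + z\<^sup>2\<close> give the terms of even and of odd index of the theta series
in \<open>\<beta>\<^sup>2\<close>.\<close>

lemma bisum_0_eq_theta:
  assumes \<beta>: "\<beta> \<noteq> 0"
  shows "bisum (\<lambda>z. 1 + z\<^sup>2) 0 \<beta> = qpoch_inf [q, - (\<beta>\<^sup>2), - q / \<beta>\<^sup>2] q"
proof -
  let ?g = "\<lambda>l. q powi triangle l * (\<beta>\<^sup>2) powi l"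
  have g: "?g summable_on A" for A
    using summable_theta[of "\<beta>\<^sup>2"] \<beta> by (auto intro: summable_on_subset)
  have even: "bij_betw (\<lambda>k::int. 2 * k) UNIV {l. even l}"
    by (rule bij_betwI[where g = "\<lambda>l. l div 2"]) auto
  have odd: "bij_betw (\<lambda>k::int. 2 * k + 1) UNIV {l. odd l}"
    by (rule bij_betwI[where g = "\<lambda>l. l div 2"]) auto
  have split: "summand (\<lambda>z. 1 + z\<^sup>2) 0 \<beta> k = ?g (2 * k) + ?g (2 * k + 1)" for k
  proof -
    have t: "triangle (2 * k) = 2 * k\<^sup>2 - k" "triangle (2 * k + 1) = (2 * k\<^sup>2 - k) + k * 2"
      using two_triangle[of "2 * k"] two_triangle[of "2 * k + 1"] by (simp_all add: algebra_simps power2_eq_square)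
    have b: "(\<beta>\<^sup>2) powi (2 * k) = \<beta> powi (4 * k)"
      using power_int_mult[of \<beta> 2 "2 * k"] by simp
    have "(\<beta>\<^sup>2) powi (2 * k + 1) = \<beta> powi (4 * k) * \<beta>\<^sup>2"
      using \<beta> by (subst power_int_add) (auto simp: b)
    moreover have "q powi ((2 * k\<^sup>2 - k) + k * 2) = q powi (2 * k\<^sup>2 - k) * (q powi k)\<^sup>2"
      by (subst power_int_add) (auto simp: power_int_mult)
    ultimately show ?thesis
      unfolding summand_def lattice_gauss_def t b by (simp add: power_mult_distrib algebra_simps)
  qed
  have "bisum (\<lambda>z. 1 + z\<^sup>2) 0 \<beta> = (\<Sum>\<^sub>\<infinity>k. ?g (2 * k) + ?g (2 * k + 1))"
    unfolding bisum_def split ..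
  also have "\<dots> = (\<Sum>\<^sub>\<infinity>k. ?g (2 * k)) + (\<Sum>\<^sub>\<infinity>k. ?g (2 * k + 1))"
    by (rule infsum_add)
       (use summable_on_reindex_bij_betw[OF even, of ?g] summable_on_reindex_bij_betw[OF odd, of ?g] g in auto)
  also have "\<dots> = (\<Sum>\<^sub>\<infinity>l\<in>{l. even l}. ?g l) + (\<Sum>\<^sub>\<infinity>l\<in>{l. odd l}. ?g l)"
    using infsum_reindex_bij_betw[OF even, of ?g] infsum_reindex_bij_betw[OF odd, of ?g] by simp
  also have "\<dots> = (\<Sum>\<^sub>\<infinity>l\<in>{l. even l} \<union> {l. odd l}. ?g l)"
    by (rule infsum_Un_disjoint[symmetric]) (auto intro: g)
  also have "{l. even l} \<union> {l. odd l} = (UNIV :: int set)" by auto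
  also have "(\<Sum>\<^sub>\<infinity>l. ?g l) = qpoch_inf [q] q * (qpoch_inf [- (\<beta>\<^sup>2)] q * qpoch_inf [- q / \<beta>\<^sup>2] q)"
    by (rule triple_product) (use \<beta> in simp)
  finally show ?thesis
    by (simp only: qpoch_inf_Cons[of _ "[_, _]"] qpoch_inf_Cons[of _ "[_]"])
qed

end

section \<open>Gaussian integrals with complex parameters\<close>

lemma integrable_real_gaussian:
  fixes c d :: real
  assumes "0 < c"
  shows "integrable lborel (\<lambda>y. exp (- c * y\<^sup>2 + d * y))"
proof -
  define \<sigma> where "\<sigma> = 1 / sqrt (2 * c)"
  define \<mu> where "\<mu> = d / (2 * c)"
  have \<sigma>: "0 < \<sigma>" "\<sigma>\<^sup>2 = 1 / (2 * c)" using assms by (simp_all add: \<sigma>_def power_divide)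
  have "exp (- c * y\<^sup>2 + d * y) = (exp (d\<^sup>2 / (4 * c)) * sqrt (2 * pi * \<sigma>\<^sup>2)) * normal_density \<mu> \<sigma> y" for y
  proof -
    have "- c * y\<^sup>2 + d * y = d\<^sup>2 / (4 * c) + - (y - \<mu>)\<^sup>2 / (2 * \<sigma>\<^sup>2)"
      unfolding \<sigma>(2) \<mu>_def using assms by (simp add: field_simps power2_eq_square)
    then show ?thesis
      using \<sigma>(1) by (simp only: exp_add normal_density_def) simp
  qed
  moreover have "integrable lborel (\<lambda>y. (exp (d\<^sup>2 / (4 * c)) * sqrt (2 * pi * \<sigma>\<^sup>2)) * normal_density \<mu> \<sigma> y)"
    using integrable_normal_density[OF \<sigma>(1)] by (rule integrable_mult_right)
  ultimately show ?thesis by simp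
qed

definition gaussian :: "complex \<Rightarrow> complex \<Rightarrow> real \<Rightarrow> complex" where
  "gaussian c d y = exp (- c * of_real (y\<^sup>2) + d * of_real y)"

lemma gaussian_measurable [measurable]: "gaussian c d \<in> borel_measurable borel"
  unfolding gaussian_def by measurable

lemma norm_gaussian: "norm (gaussian c d y) = exp (- Re c * y\<^sup>2 + Re d * y)"
  by (simp add: gaussian_def norm_exp_eq_Re)

lemma integrable_gaussian:
  assumes "0 < Re c"
  shows "integrable lborel (gaussian c d)"
  by (rule Bochner_Integration.integrable_bound[OF integrable_real_gaussian[OF assms, of "Re d"]])
     (simp_all add: norm_gaussian)

text \<open>For real \<open>c\<close> and purely imaginary linear coefficient, scaling by \<open>sqrt (2c)\<close> gives the
characteristic function of the standard normal distribution.\<close>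

lemma integral_gaussian_imaginary:
  fixes c t :: real
  assumes c: "0 < c"
  shows "(\<integral>y. gaussian (of_real c) (\<i> * of_real t) y \<partial>lborel) =
    of_real (sqrt (pi / c)) * exp ((\<i> * of_real t)\<^sup>2 / (4 * of_real c))"
proof -
  define k where "k = sqrt (2 * c)"
  have k: "0 < k" "k\<^sup>2 = 2 * c" using c by (simp_all add: k_def)
  have "(\<integral>y. gaussian (of_real c) (\<i> * of_real t) y \<partial>lborel) =
      (1 / k) *\<^sub>R (\<integral>y. gaussian (of_real c) (\<i> * of_real t) (0 + (1 / k) * y) \<partial>lborel)"
    using lborel_integral_real_affine[of "1 / k" "gaussian (of_real c) (\<i> * of_real t)" 0] k by simp
  also have "(\<lambda>y. gaussian (of_real c) (\<i> * of_real t) (0 + (1 / k) * y)) =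
      (\<lambda>y. sqrt (2 * pi) *\<^sub>R (std_normal_density y *\<^sub>R iexp (t / k * y)))"
  proof
    fix y
    have h: "c * (y / k)\<^sup>2 = y\<^sup>2 / 2" using k c by (simp add: power_divide)
    have "- complex_of_real c * of_real ((y / k)\<^sup>2) = of_real (- y\<^sup>2 / 2)"
      unfolding minus_divide_left[symmetric] h[symmetric] by simp
    then have "gaussian (of_real c) (\<i> * of_real t) (0 + (1 / k) * y) = exp (of_real (- y\<^sup>2 / 2)) * iexp (t / k * y)"
      unfolding gaussian_def exp_add[symmetric]
      by (intro arg_cong[where f = exp]) (simp add: mult_ac)
    also have "\<dots> = exp (- y\<^sup>2 / 2) *\<^sub>R iexp (t / k * y)"
      by (simp only: exp_of_real scaleR_conv_of_real)
    finally show "gaussian (of_real c) (\<i> * of_real t) (0 + (1 / k) * y) =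
        sqrt (2 * pi) *\<^sub>R (std_normal_density y *\<^sub>R iexp (t / k * y))"
      by (simp add: std_normal_density_def)
  qed
  also have "(\<integral>y. sqrt (2 * pi) *\<^sub>R (std_normal_density y *\<^sub>R iexp (t / k * y)) \<partial>lborel) =
      sqrt (2 * pi) *\<^sub>R char std_normal_distribution (t / k)"
  proof -
    have "char std_normal_distribution (t / k) =
        (\<integral>y. std_normal_density y *\<^sub>R iexp (t / k * y) \<partial>lborel)"
      unfolding char_def by (rule integral_density) auto
    then show ?thesis by (simp only: integral_scaleR_right)
  qed
  also have "char std_normal_distribution (t / k) = of_real (exp (- (t / k)\<^sup>2 / 2))"
    by (simp add: char_std_normal_distribution)
  also have "(1 / k) *\<^sub>R (sqrt (2 * pi) *\<^sub>R complex_of_real (exp (- (t / k)\<^sup>2 / 2))) =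
     of_real (sqrt (2 * pi) / k) * exp (of_real (- (t / k)\<^sup>2 / 2))"
    unfolding exp_of_real by (simp add: scaleR_conv_of_real)
  also have "of_real (- (t / k)\<^sup>2 / 2) = (\<i> * complex_of_real t)\<^sup>2 / (4 * of_real c)"
    using k c by (simp add: power_divide power_mult_distrib)
  also have "sqrt (2 * pi) / k = sqrt (pi / c)"
    by (simp add: k_def real_sqrt_divide real_sqrt_mult)
  finally show ?thesis .
qed

text \<open>The real part of \<open>d\<close> is removed by a real translation, which completes the square.\<close>

lemma integral_gaussian_real:
  fixes c :: real
  assumes c: "0 < c"
  shows "(\<integral>y. gaussian (of_real c) d y \<partial>lborel) = of_real (sqrt (pi / c)) * exp (d\<^sup>2 / (4 * of_real c))"
proof -
  define u where "u = Re d / (2 * c)"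
  have d: "d = of_real (2 * c * u) + \<i> * of_real (Im d)"
    using c by (simp add: u_def complex_eq_iff)
  define e where "e = of_real (c * u\<^sup>2) + \<i> * of_real (Im d * u)"
  have "(\<integral>y. gaussian (of_real c) d y \<partial>lborel) = (\<integral>y. gaussian (of_real c) d (u + 1 * y) \<partial>lborel)"
    using lborel_integral_real_affine[of 1 "gaussian (of_real c) d" u] by simp
  also have "\<dots> = (\<integral>y. exp e * gaussian (of_real c) (\<i> * of_real (Im d)) y \<partial>lborel)"
  proof (rule Bochner_Integration.integral_cong[OF refl])
    fix y
    show "gaussian (of_real c) d (u + 1 * y) = exp e * gaussian (of_real c) (\<i> * of_real (Im d)) y"
      unfolding gaussian_def exp_add[symmetric] e_def
      by (subst d) (simp add: algebra_simps power2_eq_square)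
  qed
  also have "\<dots> = exp e * (\<integral>y. gaussian (of_real c) (\<i> * of_real (Im d)) y \<partial>lborel)"
    by simp
  also have "\<dots> = of_real (sqrt (pi / c)) * exp (e + (\<i> * of_real (Im d))\<^sup>2 / (4 * of_real c))"
    unfolding integral_gaussian_imaginary[OF c] by (simp add: exp_add mult_ac)
  also have "e + (\<i> * of_real (Im d))\<^sup>2 / (4 * of_real c) = d\<^sup>2 / (4 * of_real c)"
    unfolding e_def by (subst (2) d) (use c in \<open>simp add: field_simps power2_eq_square\<close>)
  finally show ?thesis .
qed


text \<open>Differentiation under the integral sign: on the disc of radius \<open>Re c / 2\<close> about \<open>c\<close> the difference
quotients are dominated by one real Gaussian.\<close>

lemma integral_gaussian_has_field_derivative:
  assumes c: "0 < Re c"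
  shows "((\<lambda>w. \<integral>y. gaussian w d y \<partial>lborel) has_field_derivative
    (\<integral>y. - (of_real y)\<^sup>2 * gaussian c d y \<partial>lborel)) (at c)"
proof -
  define \<epsilon> where "\<epsilon> = Re c / 2"
  have \<epsilon>: "0 < \<epsilon>" using c by (simp add: \<epsilon>_def)
  have Re_ge: "\<epsilon> \<le> Re w" if "w \<in> ball c \<epsilon>" for w
    using abs_Re_le_cmod[of "c - w"] that by (simp add: \<epsilon>_def dist_norm)
  have deriv: "((\<lambda>w. gaussian w d y) has_field_derivative - (of_real y)\<^sup>2 * gaussian w d y) (at w within S)" for w y S
    unfolding gaussian_def by (auto intro!: derivative_eq_intros)
  have "((\<lambda>w. \<integral>y. gaussian w d y \<partial>lborel) has_field_derivative
    (\<integral>y. - (of_real y)\<^sup>2 * gaussian c d y \<partial>lborel)) (at c within ball c \<epsilon>)"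
    unfolding has_field_derivative_iff tendsto_at_iff_sequentially
  proof (intro allI impI)
    fix X assume X: "\<forall>i. X i \<in> ball c \<epsilon> - {c}" "X \<longlonglongrightarrow> c"
    have int: "integrable lborel (gaussian w d)" if "w \<in> ball c \<epsilon>" for w
      using Re_ge[OF that] \<epsilon> by (intro integrable_gaussian) simp
    have "(\<lambda>i. \<integral>y. (gaussian (X i) d y - gaussian c d y) / (X i - c) \<partial>lborel)
        \<longlonglongrightarrow> (\<integral>y. - (of_real y)\<^sup>2 * gaussian c d y \<partial>lborel)"
    proof (rule integral_dominated_convergence)
      show "integrable lborel (\<lambda>y. 2 / \<epsilon> * exp (- (\<epsilon> / 2) * y\<^sup>2 + Re d * y))"
        using \<epsilon> by (intro integrable_mult_right integrable_real_gaussian) simp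
      show "AE y in lborel. (\<lambda>i. (gaussian (X i) d y - gaussian c d y) / (X i - c))
          \<longlonglongrightarrow> - (of_real y)\<^sup>2 * gaussian c d y"
      proof (rule AE_I2)
        fix y
        show "(\<lambda>i. (gaussian (X i) d y - gaussian c d y) / (X i - c)) \<longlonglongrightarrow> - (of_real y)\<^sup>2 * gaussian c d y"
          using deriv[of y c "ball c \<epsilon>"] X
          unfolding has_field_derivative_iff tendsto_at_iff_sequentially by (auto simp: o_def)
      qed
      show "AE y in lborel. norm ((gaussian (X i) d y - gaussian c d y) / (X i - c))
          \<le> 2 / \<epsilon> * exp (- (\<epsilon> / 2) * y\<^sup>2 + Re d * y)" for i
      proof (rule AE_I2)
        fix y :: real
        let ?M = "2 / \<epsilon> * exp (- (\<epsilon> / 2) * y\<^sup>2 + Re d * y)"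
        have Xi: "X i \<in> ball c \<epsilon>" "X i \<noteq> c" using X by auto
        have "norm (- (of_real y)\<^sup>2 * gaussian w d y) \<le> ?M" if "w \<in> ball c \<epsilon>" for w
        proof -
          have "norm (- (of_real y)\<^sup>2 * gaussian w d y) = y\<^sup>2 * exp (- Re w * y\<^sup>2 + Re d * y)"
            by (simp add: norm_mult norm_power norm_gaussian)
          also have "\<dots> \<le> y\<^sup>2 * exp (- \<epsilon> * y\<^sup>2 + Re d * y)"
            using Re_ge[OF that] by (intro mult_left_mono) (auto intro!: mult_right_mono)
          also have "\<dots> = 2 / \<epsilon> * ((\<epsilon> / 2 * y\<^sup>2) * exp (- \<epsilon> * y\<^sup>2 + Re d * y))"
            using \<epsilon> by simp
          also have "\<dots> \<le> 2 / \<epsilon> * (exp (\<epsilon> / 2 * y\<^sup>2) * exp (- \<epsilon> * y\<^sup>2 + Re d * y))"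
          proof (intro mult_left_mono mult_right_mono)
            show "\<epsilon> / 2 * y\<^sup>2 \<le> exp (\<epsilon> / 2 * y\<^sup>2)"
              using exp_ge_add_one_self[of "\<epsilon> / 2 * y\<^sup>2"] by linarith
          qed (use \<epsilon> in auto)
          also have "exp (\<epsilon> / 2 * y\<^sup>2) * exp (- \<epsilon> * y\<^sup>2 + Re d * y) = exp (- (\<epsilon> / 2) * y\<^sup>2 + Re d * y)"
            unfolding exp_add[symmetric] by (simp add: algebra_simps)
          finally show ?thesis .
        qed
        then have "norm (gaussian (X i) d y - gaussian c d y) \<le> ?M * norm (X i - c)"
          by (intro field_differentiable_bound[OF convex_ball deriv _ Xi(1)]) (use \<epsilon> in auto)
        then show "norm ((gaussian (X i) d y - gaussian c d y) / (X i - c)) \<le> ?M"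
          using Xi(2) by (simp add: norm_divide divide_le_eq)
      qed
    qed (auto simp: gaussian_def)
    moreover have "(\<integral>y. (gaussian (X i) d y - gaussian c d y) / (X i - c) \<partial>lborel) =
        ((\<integral>y. gaussian (X i) d y \<partial>lborel) - (\<integral>y. gaussian c d y \<partial>lborel)) / (X i - c)" for i
      using int[of "X i"] int[of c] X \<epsilon> by auto
    ultimately show "((\<lambda>w. ((\<integral>y. gaussian w d y \<partial>lborel) - (\<integral>y. gaussian c d y \<partial>lborel)) / (w - c)) \<circ> X)
        \<longlonglongrightarrow> (\<integral>y. - (of_real y)\<^sup>2 * gaussian c d y \<partial>lborel)"
      by (simp only: o_def)
  qed
  then show ?thesis
    using \<epsilon> by (simp add: at_within_open[of c "ball c \<epsilon>"])
qed

text \<open>Both sides are holomorphic in the right half-plane and agree on the positive real axis.\<close>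

lemma integral_gaussian:
  assumes "0 < Re c"
  shows "(\<integral>y. gaussian c d y \<partial>lborel) = of_real (sqrt pi) / csqrt c * exp (d\<^sup>2 / (4 * c))"
proof -
  let ?S = "{w. 0 < Re w}"
  let ?U = "complex_of_real ` {0<..}"
  define h where "h w = (\<integral>y. gaussian w d y \<partial>lborel) - of_real (sqrt pi) / csqrt w * exp (d\<^sup>2 / (4 * w))" for w
  have "h c = 0"
  proof (rule analytic_continuation[of h ?S ?U 1])
    have "(\<lambda>w. \<integral>y. gaussian w d y \<partial>lborel) holomorphic_on ?S"
      using integral_gaussian_has_field_derivative
      by (auto simp: holomorphic_on_def field_differentiable_def intro: has_field_derivative_at_within)
    moreover have "(\<lambda>w. of_real (sqrt pi) / csqrt w * exp (d\<^sup>2 / (4 * w))) holomorphic_on ?S"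
      by (intro holomorphic_intros) (auto simp: complex_nonpos_Reals_iff)
    ultimately show "h holomorphic_on ?S"
      unfolding h_def by (rule holomorphic_on_diff)
    show "open ?S" by (simp add: open_halfspace_Re_gt)
    show "connected ?S" by (simp add: convex_connected convex_halfspace_Re_gt)
    have "(1::real) islimpt {0<..}"
      by (rule interior_limit_point) (simp add: interior_open)
    then have "complex_of_real 1 islimpt ?U"
      unfolding islimpt_sequential
    proof (elim exE conjE)
      fix f :: "nat \<Rightarrow> real" assume f: "\<forall>n. f n \<in> {0<..} - {1}" "f \<longlonglongrightarrow> 1"
      show "\<exists>f. (\<forall>n. f n \<in> ?U - {complex_of_real 1}) \<and> f \<longlonglongrightarrow> complex_of_real 1"
        by (rule exI[of _ "\<lambda>n. complex_of_real (f n)"]) (use f in \<open>auto intro!: tendsto_of_real simp del: of_real_1\<close>)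
    qed
    then show "1 islimpt ?U" by simp
    show "h z = 0" if "z \<in> ?U" for z
      using that by (auto simp: h_def integral_gaussian_real real_sqrt_divide csqrt_of_real_nonneg)
  qed (use assms in auto)
  then show ?thesis by (simp add: h_def)
qed

section \<open>Cutting the line into unit intervals\<close>

text \<open>Both integrals are the sum of the integrals of \<open>f\<close> over the intervals \<open>[k, k+1]\<close>; the
majorant \<open>M\<close> justifies the interchange of sum and integral.\<close>

lemma
  fixes f :: "real \<Rightarrow> complex" and M :: "int \<Rightarrow> real"
  assumes f [measurable]: "f \<in> borel_measurable borel"
      and M: "M summable_on UNIV"
      and bound: "\<And>x k. 0 \<le> x \<Longrightarrow> x \<le> 1 \<Longrightarrow> norm (f (x + of_int k)) \<le> M k"
  shows integrable_unfold: "integrable lborel f"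
    and set_integrable_unfold: "set_integrable lborel {0..1} (\<lambda>x. \<Sum>\<^sub>\<infinity>k. f (x + of_int k))"
    and integral_unfold: "(LBINT x. f x) = (LBINT x:{0..1}. \<Sum>\<^sub>\<infinity>k. f (x + of_int k))"
proof -
  define e where "e i = int_decode i" for i
  have e: "bij_betw e UNIV UNIV" unfolding e_def by (rule bij_int_decode)
  \<comment> \<open>Half-open intervals are disjoint, so \<open>f\<close> is the sum of the pieces \<open>A\<close> everywhere; translated to
      the origin they are the \<open>A'\<close>, which differ from \<open>B\<close> only at the point \<open>1\<close>.\<close>
  define A where "A i x = indicator {0..<1} (x - of_int (e i)) *\<^sub>R f x" for i x
  define A' where "A' i x = indicator {0..<1} x *\<^sub>R f (x + of_int (e i))" for i x
  define B where "B i x = indicator {0..1} x *\<^sub>R f (x + of_int (e i))" for i x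
  have meas [measurable]: "A i \<in> borel_measurable borel" "A' i \<in> borel_measurable borel" "B i \<in> borel_measurable borel" for i
    unfolding A_def A'_def B_def by measurable
  have "(\<lambda>i. M (e i)) summable_on UNIV"
    using summable_on_reindex_bij_betw[OF e, of M] M by simp
  then have sum_M: "summable (\<lambda>i. M (e i))" by (rule summable_on_imp_summable)
  have M0: "0 \<le> M k" for k using bound[of 0 k] norm_ge_zero order_trans by (metis zero_le_one order_refl)
  have norm_B: "norm (B i x) \<le> indicator {0..1} x * M (e i)" for i x
    using bound[of x "e i"] by (auto simp: B_def split: split_indicator)
  have norm_A': "norm (A' i x) \<le> indicator {0..1} x * M (e i)" for i x
    using bound[of x "e i"] M0 by (auto simp: A'_def split: split_indicator)
  have int_M: "integrable lborel (\<lambda>x::real. indicator {0..1} x * M (e i))" for i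
    by (intro integrable_mult_left integrable_real_indicator) auto
  have int_B: "integrable lborel (B i)" for i
    by (rule Bochner_Integration.integrable_bound[OF int_M]) (use norm_B M0 in \<open>auto simp: abs_mult\<close>)
  have int_A': "integrable lborel (A' i)" for i
    by (rule Bochner_Integration.integrable_bound[OF int_M]) (use norm_A' M0 in \<open>auto simp: abs_mult\<close>)
  have shift: "A i (of_int (e i) + 1 * x) = A' i x" for i x
    by (simp add: A_def A'_def add.commute)
  have int_A: "integrable lborel (A i)" for i
    using lborel_integrable_real_affine_iff[of 1 "A i" "of_int (e i)"] int_A'[of i] by (simp only: shift one_neq_zero not_False_eq_True simp_thms)
  have eq_A_A': "integral\<^sup>L lborel (A i) = integral\<^sup>L lborel (A' i)" for i
    using lborel_integral_real_affine[of 1 "A i" "of_int (e i)"] by (simp only: shift) simp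
  have eq_norm: "(\<integral>x. norm (A i x) \<partial>lborel) = (\<integral>x. norm (A' i x) \<partial>lborel)" for i
    using lborel_integral_real_affine[of 1 "\<lambda>x. norm (A i x)" "of_int (e i)"] by (simp only: shift) simp
  have eq_A'_B: "integral\<^sup>L lborel (A' i) = integral\<^sup>L lborel (B i)" for i
  proof (rule integral_cong_AE)
    show "AE x in lborel. A' i x = B i x"
      using AE_lborel_singleton[of "1::real"]
      by eventually_elim (auto simp: A'_def B_def split: split_indicator)
  qed auto
  have le: "(\<integral>x. norm (h x) \<partial>lborel) \<le> M (e i)"
    if "integrable lborel h" "\<And>x. norm (h x) \<le> indicator {0..1} x * M (e i)" for h :: "real \<Rightarrow> complex" and i
  proof -
    have "(\<integral>x. norm (h x) \<partial>lborel) \<le> (\<integral>x. indicator {0..1::real} x * M (e i) \<partial>lborel)"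
      by (rule Bochner_Integration.integral_mono[OF integrable_norm[OF that(1)] int_M that(2)])
    then show ?thesis by simp
  qed
  have sumA: "summable (\<lambda>i. \<integral>x. norm (A i x) \<partial>lborel)"
    unfolding eq_norm
    by (rule summable_comparison_test[OF _ sum_M]) (use le[OF int_A' norm_A'] in auto)
  have sumB: "summable (\<lambda>i. \<integral>x. norm (B i x) \<partial>lborel)"
    by (rule summable_comparison_test[OF _ sum_M]) (use le[OF int_B norm_B] in auto)
  have A_sums: "(\<lambda>i. A i x) sums f x" and A_abs: "summable (\<lambda>i. norm (A i x))" for x
  proof -
    define i0 where "i0 = inv e \<lfloor>x\<rfloor>"
    have i0: "e i0 = \<lfloor>x\<rfloor>" using e by (simp add: i0_def bij_is_surj surj_f_inv_f)
    have one: "A i x = (if i = i0 then f x else 0)" for i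
    proof (cases "i = i0")
      case True
      then show ?thesis by (auto simp: A_def i0 indicator_def) linarith+
    next
      case False
      then have "e i \<noteq> \<lfloor>x\<rfloor>" using i0 e by (metis bij_is_inj injD)
      then have "\<not> (0 \<le> x - of_int (e i) \<and> x - of_int (e i) < 1)"
        by (auto simp: floor_eq_iff eq_commute[of "e i"])
      then show ?thesis using False by (simp add: A_def)
    qed
    have "(\<lambda>i. A i x) = (\<lambda>i. if i = i0 then f x else 0)" by (rule ext) (rule one)
    then show "(\<lambda>i. A i x) sums f x" using sums_single[of i0 "\<lambda>_. f x"] by simp
    have "(\<lambda>i. norm (A i x)) = (\<lambda>i. if i = i0 then norm (f x) else 0)" by (auto simp: one)
    then show "summable (\<lambda>i. norm (A i x))" using summable_single[of i0 "\<lambda>_. norm (f x)"] by simp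
  qed
  have B_abs: "summable (\<lambda>i. norm (B i x))" for x
  proof (rule summable_comparison_test[OF _ sum_M])
    have "norm (B i x) \<le> M (e i)" for i
      using norm_B[of i x] M0[of "e i"] by (auto split: split_indicator_asm)
    then show "\<exists>N. \<forall>i\<ge>N. norm (norm (B i x)) \<le> M (e i)" by simp
  qed
  have B_sum: "(\<Sum>i. B i x) = indicator {0..1} x *\<^sub>R (\<Sum>\<^sub>\<infinity>k. f (x + of_int k))" for x
  proof (cases "x \<in> {0..1}")
    case True
    have "(\<lambda>k. norm (f (x + of_int k))) summable_on UNIV"
      by (rule summable_on_comparison_test[OF M]) (use True bound in auto)
    then have "(\<lambda>k. f (x + of_int k)) summable_on UNIV" by (rule abs_summable_summable)
    then have "((\<lambda>k. f (x + of_int k)) has_sum (\<Sum>\<^sub>\<infinity>k. f (x + of_int k))) UNIV" by simp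
    then have "((\<lambda>i. f (x + of_int (e i))) has_sum (\<Sum>\<^sub>\<infinity>k. f (x + of_int k))) UNIV"
      using has_sum_reindex_bij_betw[OF e, of "\<lambda>k. f (x + of_int k)"] by simp
    then have "(\<lambda>i. f (x + of_int (e i))) sums (\<Sum>\<^sub>\<infinity>k. f (x + of_int k))"
      by (rule has_sum_imp_sums)
    then show ?thesis using True by (simp add: B_def sums_unique[symmetric])
  qed (simp add: B_def)
  have A_sum: "(\<Sum>i. A i x) = f x" for x using A_sums[of x] by (simp add: sums_unique[symmetric])
  show "integrable lborel f"
    using integrable_suminf[OF int_A AE_I2[OF A_abs] sumA] by (simp add: A_sum)
  show "set_integrable lborel {0..1} (\<lambda>x. \<Sum>\<^sub>\<infinity>k. f (x + of_int k))"
    unfolding set_integrable_def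
    using integrable_suminf[OF int_B AE_I2[OF B_abs] sumB] by (simp only: B_sum)
  have "(LBINT x. f x) = (\<Sum>i. integral\<^sup>L lborel (A i))"
    using integral_suminf[OF int_A AE_I2[OF A_abs] sumA] by (simp add: A_sum)
  also have "\<dots> = (\<Sum>i. integral\<^sup>L lborel (B i))"
    by (simp add: eq_A_A' eq_A'_B)
  also have "\<dots> = (LBINT x. \<Sum>i. B i x)"
    using integral_suminf[OF int_B AE_I2[OF B_abs] sumB] by simp
  also have "\<dots> = (LBINT x:{0..1}. \<Sum>\<^sub>\<infinity>k. f (x + of_int k))"
    unfolding B_sum set_lebesgue_integral_def ..
  finally show "(LBINT x. f x) = (LBINT x:{0..1}. \<Sum>\<^sub>\<infinity>k. f (x + of_int k))" .
qed

section \<open>Integrals along the spiral\<close>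

lemma csqrt_2_mult: "0 < Re z \<Longrightarrow> csqrt (2 * z) = of_real (sqrt 2) * csqrt z"
proof (rule csqrt_unique)
  show "(of_real (sqrt 2) * csqrt z)\<^sup>2 = 2 * z"
    by (simp add: power_mult_distrib flip: of_real_power)
  assume z: "0 < Re z"
  then have "0 < Re (csqrt z)"
    by (metis add_pos_nonneg csqrt.sel(1) half_gt_zero norm_ge_zero real_sqrt_gt_zero add.commute)
  then show "0 < Re (of_real (sqrt 2) * csqrt z) \<or> Re (of_real (sqrt 2) * csqrt z) = 0 \<and> 0 \<le> Im (of_real (sqrt 2) * csqrt z)"
    by simp
qed

locale nome_spiral = nome +
  fixes \<alpha> :: complex
  assumes \<alpha>_nonzero [simp]: "\<alpha> \<noteq> 0"
begin

text \<open>As \<open>x\<close> runs through the reals, \<open>q\<^sup>x \<alpha>\<close> runs through a logarithmic spiral; an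
integer translation of \<open>x\<close> is a step on the lattice \<open>q\<^sup>k \<beta>\<close>.\<close>

definition spiral :: "real \<Rightarrow> complex" where "spiral x = q powr of_real x * \<alpha>"

definition spiral_gauss :: "real \<Rightarrow> complex" where
  "spiral_gauss x = q powr of_real (2 * x\<^sup>2 - x) * \<alpha> powr of_real (4 * x)"

lemma spiral_nonzero [simp]: "spiral x \<noteq> 0"
  by (simp add: spiral_def)

lemma Re_Ln_q: "Re (Ln q) = ln (norm q)" "ln (norm q) < 0"
  using norm_q_pos norm_q_less_1 by (auto simp: Re_Ln)

text \<open>With the principal logarithms the continuous weight is an ordinary Gaussian with leading
coefficient \<open>2 log q\<^sup>-\<^sup>1\<close>, whose real part is positive.\<close>

lemma spiral_gauss_eq_gaussian: "spiral_gauss = gaussian (2 * - Ln q) (4 * Ln \<alpha> - Ln q)"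
  by (rule ext) (simp add: spiral_gauss_def gaussian_def powr_def exp_add[symmetric] algebra_simps)

lemma spiral_add_int: "spiral (x + of_int k) = q powi k * spiral x"
  by (simp add: spiral_def powr_add complex_powr_of_int mult_ac)

text \<open>This cocycle relation makes the integrand on \<open>[k, k+1]\<close> a term of the bilateral sum.\<close>

lemma spiral_gauss_add_int: "spiral_gauss (x + of_int k) = spiral_gauss x * lattice_gauss (spiral x) k"
proof -
  have powi: "w powi j = exp (of_int j * Ln w)" if "w \<noteq> 0" for w j
    using exp_power_int[of "Ln w" j] that by simp
  have spiral: "spiral x = exp (of_real x * Ln q + Ln \<alpha>)"
    by (simp add: spiral_def powr_def exp_add)
  have spiral_powi: "spiral x powi (4 * k) = exp (of_int (4 * k) * (of_real x * Ln q + Ln \<alpha>))"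
    unfolding spiral by (simp add: exp_power_int)
  show ?thesis
    unfolding spiral_gauss_def lattice_gauss_def spiral_powi powi[OF q_nonzero] powr_def
    by (simp add: exp_add[symmetric] algebra_simps power2_eq_square)
qed

lemma spiral_measurable [measurable]: "spiral \<in> borel_measurable borel"
  unfolding spiral_def powr_def by simp measurable

lemma spiral_gauss_measurable [measurable]: "spiral_gauss \<in> borel_measurable borel"
  unfolding spiral_gauss_eq_gaussian by measurable

lemma weight_measurable [measurable]: "(\<lambda>x. weight a (spiral x)) \<in> borel_measurable borel"
  unfolding weight_def qpoch_inf_Cons[of _ "[_]"] by measurable

lemma norm_spiral: "norm (spiral x) = exp (x * ln (norm q)) * norm \<alpha>"
  by (simp add: spiral_def powr_def norm_mult norm_exp_eq_Re Re_Ln_q)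

lemma
  assumes f: "moderate f" and f_meas [measurable]: "(\<lambda>x. f (spiral x)) \<in> borel_measurable borel"
  shows integrable_summand: "integrable lborel (\<lambda>x. f (spiral x) * weight a (spiral x) * spiral_gauss x)"
    and set_integrable_bisum: "set_integrable lborel {0..1} (\<lambda>x. bisum f a (spiral x) * spiral_gauss x)"
    and integral_summand: "(LBINT x. f (spiral x) * weight a (spiral x) * spiral_gauss x) =
      (LBINT x:{0..1}. bisum f a (spiral x) * spiral_gauss x)"
proof -
  let ?F = "\<lambda>x. f (spiral x) * weight a (spiral x) * spiral_gauss x"
  have shift: "?F (x + of_int k) = summand f a (spiral x) k * spiral_gauss x" for x k
    by (simp add: summand_def spiral_add_int spiral_gauss_add_int mult_ac)
  have "continuous_on {0..1} spiral_gauss"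
    unfolding spiral_gauss_eq_gaussian gaussian_def by (intro continuous_intros)
  then have "compact (spiral_gauss ` {0..1})" by (intro compact_continuous_image) auto
  then obtain T where "\<forall>x\<in>{0..1}. norm (spiral_gauss x) \<le> T"
    using compact_imp_bounded[of "spiral_gauss ` {0..1}"] unfolding bounded_iff by blast
  then have T: "norm (spiral_gauss x) \<le> T" if "0 \<le> x" "x \<le> 1" for x using that by simp
  have T0: "0 \<le> T" using T[of 0] norm_ge_zero order_trans by (metis zero_le_one order_refl)
  define B where "B = max 1 (max (norm \<alpha>) (1 / (norm q * norm \<alpha>)))"
  have B1: "1 \<le> B" by (simp add: B_def)
  have B: "norm (spiral x) \<le> B" "1 / norm (spiral x) \<le> B" if "0 \<le> x" "x \<le> 1" for x
  proof -
    have "exp (x * ln (norm q)) \<le> exp 0"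
      using that Re_Ln_q(2) by (simp add: mult_nonneg_nonpos)
    then have "norm (spiral x) \<le> 1 * norm \<alpha>"
      unfolding norm_spiral by (intro mult_right_mono) auto
    then show "norm (spiral x) \<le> B" by (simp add: B_def)
    have "1 * ln (norm q) \<le> x * ln (norm q)"
      using that Re_Ln_q(2) by (intro mult_right_mono_neg) auto
    then have "exp (ln (norm q)) \<le> exp (x * ln (norm q))"
      by (simp only: exp_le_cancel_iff mult_1_left)
    then have "norm q \<le> exp (x * ln (norm q))"
      by (simp only: exp_ln[OF norm_q_pos])
    then have "norm q * norm \<alpha> \<le> norm (spiral x)"
      unfolding norm_spiral by (intro mult_right_mono) auto
    then have "1 / norm (spiral x) \<le> 1 / (norm q * norm \<alpha>)"
      using norm_q_pos by (intro divide_left_mono mult_pos_pos) auto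
    then show "1 / norm (spiral x) \<le> B" by (simp add: B_def)
  qed
  from summand_bound[OF f B1 norm_ge_zero[of a]]
  obtain C D where CD: "0 \<le> C" "0 \<le> D"
    "\<And>\<beta> a' k. \<beta> \<noteq> 0 \<Longrightarrow> norm \<beta> \<le> B \<Longrightarrow> 1 / norm \<beta> \<le> B \<Longrightarrow> norm a' \<le> norm a \<Longrightarrow>
       norm (summand f a' \<beta> k) \<le> C * D ^ nat \<bar>k\<bar> * norm q ^ (nat \<bar>k\<bar>)\<^sup>2" by blast
  define M where "M k = C * D ^ nat \<bar>k\<bar> * norm q ^ (nat \<bar>k\<bar>)\<^sup>2 * T" for k :: int
  have meas: "?F \<in> borel_measurable borel" by measurable
  have M: "M summable_on UNIV"
    unfolding M_def by (rule summable_on_cmult_left[OF summable_majorant[OF CD(1,2)]])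
  have bound: "norm (?F (x + of_int k)) \<le> M k" if "0 \<le> x" "x \<le> 1" for x k
    unfolding shift norm_mult M_def using CD T0 B[OF that] T[OF that] by (intro mult_mono CD(3)) auto
  have sum: "(\<Sum>\<^sub>\<infinity>k. ?F (x + of_int k)) = bisum f a (spiral x) * spiral_gauss x" for x
    unfolding shift bisum_def by (rule infsum_cmult_left')
  show "integrable lborel ?F"
    by (rule integrable_unfold[OF meas M bound])
  show "set_integrable lborel {0..1} (\<lambda>x. bisum f a (spiral x) * spiral_gauss x)"
    using set_integrable_unfold[OF meas M bound] by (simp only: sum)
  show "(LBINT x. ?F x) = (LBINT x:{0..1}. bisum f a (spiral x) * spiral_gauss x)"
    using integral_unfold[OF meas M bound] by (simp only: sum)
qed

lemma integral_spiral_gauss: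
  "(LBINT x. spiral_gauss x) = of_real (sqrt pi) / (of_real (sqrt 2) * csqrt (- Ln q)) *
     (\<alpha> * exp (2 * (Ln \<alpha>)\<^sup>2 / (- Ln q)) / q powr (1 / 8))"
proof -
  have pos: "0 < Re (- Ln q)" using Re_Ln_q by simp
  have L: "Ln q \<noteq> 0"
  proof
    assume 0: "Ln q = 0"
    show False using pos unfolding 0 by simp
  qed
  have "(4 * Ln \<alpha> - Ln q)\<^sup>2 / (4 * (2 * - Ln q)) = Ln \<alpha> + 2 * (Ln \<alpha>)\<^sup>2 / (- Ln q) - 1 / 8 * Ln q"
    using L by (simp add: field_simps power2_eq_square)
  then have "exp ((4 * Ln \<alpha> - Ln q)\<^sup>2 / (4 * (2 * - Ln q))) =
      \<alpha> * exp (2 * (Ln \<alpha>)\<^sup>2 / (- Ln q)) / q powr (1 / 8)"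
    by (simp only: exp_diff exp_add powr_def) simp
  then show ?thesis
    unfolding spiral_gauss_eq_gaussian
    using integral_gaussian[of "2 * - Ln q" "4 * Ln \<alpha> - Ln q"] pos
    by (simp only: csqrt_2_mult[OF pos]) simp
qed

lemma integrable_spiral_gauss: "integrable lborel spiral_gauss"
  unfolding spiral_gauss_eq_gaussian by (rule integrable_gaussian) (use Re_Ln_q in simp)

lemma spiral_gauss_half: "(spiral x)\<^sup>2 * spiral_gauss x = spiral_gauss (x + 1 / 2)"
proof -
  have "spiral x = exp (of_real x * Ln q + Ln \<alpha>)"
    by (simp add: spiral_def powr_def exp_add)
  then have "(spiral x)\<^sup>2 = exp (2 * (of_real x * Ln q + Ln \<alpha>))"
    by (simp only: exp_double)
  then show ?thesis
    unfolding spiral_gauss_def powr_def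
    by (simp add: exp_add[symmetric] algebra_simps power2_eq_square)
qed

text \<open>With \<open>a = 0\<close> the weight is \<open>1\<close>, and the summand \<open>z\<^sup>2\<close> only translates the Gaussian by \<open>1/2\<close>.
Hence the theta integral over \<open>[0, 1]\<close> is twice the Gaussian integral over the line.\<close>

lemma integral_theta:
  "(LBINT x:{0..1}. bisum (\<lambda>z. 1 + z\<^sup>2) 0 (spiral x) * spiral_gauss x) = 2 * (LBINT x. spiral_gauss x)"
proof -
  have "moderate (\<lambda>z. 1 + z\<^sup>2)" by auto
  then have "(LBINT x:{0..1}. bisum (\<lambda>z. 1 + z\<^sup>2) 0 (spiral x) * spiral_gauss x) =
      (LBINT x. (1 + (spiral x)\<^sup>2) * weight 0 (spiral x) * spiral_gauss x)"
    by (rule integral_summand[symmetric]) measurable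
  also have "\<dots> = (LBINT x. spiral_gauss x + spiral_gauss (1 / 2 + 1 * x))"
    by (simp add: distrib_right spiral_gauss_half add.commute)
  also have "\<dots> = (LBINT x. spiral_gauss x) + (LBINT x. spiral_gauss (1 / 2 + 1 * x))"
    using integrable_spiral_gauss lborel_integrable_real_affine_iff[of 1 spiral_gauss "1 / 2"]
    by (intro Bochner_Integration.integral_add) auto
  also have "(LBINT x. spiral_gauss (1 / 2 + 1 * x)) = (LBINT x. spiral_gauss x)"
    using lborel_integral_real_affine[of 1 spiral_gauss "1 / 2"] by simp
  finally show ?thesis by simp
qed

end

theorem theorem4p2:
  fixes n m :: nat and q \<alpha> a :: complex
  assumes "0 < norm q" and "norm q < 1" and "\<alpha> \<noteq> 0" and "a \<noteq> 0"
  shows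
    "let
       \<delta> = (if m = n then 1 else 0 :: complex);
       F = (\<lambda>x::real.
             (1 + q powr of_real (2 * x) * \<alpha>\<^sup>2)
             * big_qinv_Hermite n (q powr of_real x * \<alpha>) a q
             * big_qinv_Hermite m (q powr of_real x * \<alpha>) a q
             * qpoch_inf [- (q powr of_real (x + 1)) * \<alpha> * a, q powr of_real (1 - x) * a / \<alpha>] q
             * q powr of_real (2 * x\<^sup>2 - x) * \<alpha> powr of_real (4 * x));
       G = (\<lambda>x::real.
             Psi m n (q powr of_real x * \<alpha>) a q
             * q powr of_real (2 * x\<^sup>2 - x) * \<alpha> powr of_real (4 * x));
       K = (\<lambda>x::real.
             qpoch_inf [- (q powr of_real (2 * x)) * \<alpha>\<^sup>2, - (q powr of_real (1 - 2 * x)) / \<alpha>\<^sup>2] q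
             * q powr of_real (2 * x\<^sup>2 - x) * \<alpha> powr of_real (4 * x))
     in
       (\<forall>\<beta>. \<beta> \<noteq> 0 \<longrightarrow> Psi_term m n \<beta> a q summable_on UNIV) \<and>
       integrable lborel F \<and>
       set_integrable lborel {0..1} G \<and>
       set_integrable lborel {0..1} K \<and>
       Psi m n \<alpha> a q =
         qpoch_inf [q, - (\<alpha>\<^sup>2), - q / \<alpha>\<^sup>2] q
         * (q powi (- int (n choose 2)) * qpoch [q] q n / q ^ n) * \<delta> \<and>
       (LBINT x. F x) = (LBINT x:{0..1}. G x) \<and>
       (LBINT x:{0..1}. G x) =
         qpoch_inf [q] q * (q powi (- int (n choose 2)) * qpoch [q] q n * \<delta> / q ^ n)
         * (LBINT x:{0..1}. K x) \<and>
       qpoch_inf [q] q * (q powi (- int (n choose 2)) * qpoch [q] q n * \<delta> / q ^ n)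
         * (LBINT x:{0..1}. K x) =
         of_real (sqrt (2 * pi)) * \<alpha> * exp (2 * (Ln \<alpha>)\<^sup>2 / (- Ln q))
         / (q powr (1 / 8) * csqrt (- Ln q))
         * (q powi (- int (n choose 2)) * qpoch [q] q n / q ^ n) * \<delta>"
proof -
  interpret nome_spiral q \<alpha>
    by unfold_locales (use assms in auto)
  note a = \<open>a \<noteq> 0\<close>
  define \<delta> where "\<delta> = (if m = n then 1 else 0 :: complex)"
  define F where "F = (\<lambda>x::real.
             (1 + q powr of_real (2 * x) * \<alpha>\<^sup>2)
             * big_qinv_Hermite n (q powr of_real x * \<alpha>) a q
             * big_qinv_Hermite m (q powr of_real x * \<alpha>) a q
             * qpoch_inf [- (q powr of_real (x + 1)) * \<alpha> * a, q powr of_real (1 - x) * a / \<alpha>] q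
             * q powr of_real (2 * x\<^sup>2 - x) * \<alpha> powr of_real (4 * x))"
  define G where "G = (\<lambda>x::real.
             Psi m n (q powr of_real x * \<alpha>) a q
             * q powr of_real (2 * x\<^sup>2 - x) * \<alpha> powr of_real (4 * x))"
  define K where "K = (\<lambda>x::real.
             qpoch_inf [- (q powr of_real (2 * x)) * \<alpha>\<^sup>2, - (q powr of_real (1 - 2 * x)) / \<alpha>\<^sup>2] q
             * q powr of_real (2 * x\<^sup>2 - x) * \<alpha> powr of_real (4 * x))"
  define f where "f z = (1 + z\<^sup>2) * poly (hermite_poly m a) (z - 1 / z) * poly (hermite_poly n a) (z - 1 / z)" for z
  define \<mu> where "\<mu> = bisum (\<lambda>z. 1 + z\<^sup>2) 0"
  define h where "h = q powi (- int (n choose 2)) * qpoch [q] q n / q ^ n"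
  define I where "I = qpoch_inf [q] q"
  have I: "I \<noteq> 0" unfolding I_def by (rule qpoch_inf_nonzero[OF norm_q_less_1])
  have f: "moderate f" unfolding f_def by auto
  have h_eq: "qpoch [q] q n / (q ^ (n choose 2) * q ^ n) = h"
    by (simp add: h_def power_int_minus divide_inverse mult_ac)
  have Psi: "Psi m n \<beta> a q = \<mu> \<beta> * (\<delta> * h)" if "\<beta> \<noteq> 0" for \<beta>
    unfolding Psi_eq[OF that a] h_eq \<mu>_def \<delta>_def ..
  have Psi': "Psi m n \<beta> a q = bisum f a \<beta>" if "\<beta> \<noteq> 0" for \<beta>
    unfolding Psi_def bisum_def f_def Psi_term_eq[OF that a] ..
  have powr_double: "q powr of_real (2 * x) * \<alpha>\<^sup>2 = (spiral x)\<^sup>2" for x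
    by (simp add: spiral_def powr_def power_mult_distrib mult.assoc flip: exp_double)
  have powr_1_minus: "q powr of_real (1 - y) = q / q powr of_real y" for y
    by (simp add: powr_diff)
  have F: "F x = f (spiral x) * weight a (spiral x) * spiral_gauss x" for x
  proof -
    have "- (q powr of_real (x + 1)) * \<alpha> * a = - (q * a * spiral x)"
      by (simp add: spiral_def powr_add)
    moreover have "q powr of_real (1 - x) * a / \<alpha> = q * a / spiral x"
      unfolding powr_1_minus by (simp add: spiral_def)
    ultimately show ?thesis
      unfolding F_def f_def weight_def spiral_gauss_def powr_double spiral_def[symmetric] big_qinv_Hermite_eq_poly[OF a spiral_nonzero]
      by (simp only: mult_ac)
  qed
  have G: "G x = bisum f a (spiral x) * spiral_gauss x" for x
    unfolding G_def spiral_def[symmetric] Psi'[OF spiral_nonzero] spiral_gauss_def by (simp only: mult.assoc)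
  have G': "G x = (\<delta> * h) * (\<mu> (spiral x) * spiral_gauss x)" for x
    unfolding G_def spiral_def[symmetric] Psi[OF spiral_nonzero] spiral_gauss_def by (simp only: mult_ac)
  have K: "\<mu> (spiral x) * spiral_gauss x = I * K x" for x
  proof -
    have "- (q powr of_real (2 * x)) * \<alpha>\<^sup>2 = - ((spiral x)\<^sup>2)"
      by (simp only: mult_minus_left powr_double)
    moreover have "- (q powr of_real (1 - 2 * x)) / \<alpha>\<^sup>2 = - q / (spiral x)\<^sup>2"
      unfolding powr_1_minus powr_double[symmetric] by simp
    ultimately show ?thesis
      unfolding \<mu>_def bisum_0_eq_theta[OF spiral_nonzero] qpoch_inf_Cons[of _ "[_, _]"] K_def I_def spiral_gauss_def
      by (simp only: mult_ac)
  qed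
  have f_meas: "(\<lambda>x. f (spiral x)) \<in> borel_measurable borel"
  proof -
    have "(\<lambda>x. poly p (spiral x - 1 / spiral x)) \<in> borel_measurable borel" for p
      by (rule borel_measurable_continuous_on[where f = "poly p"]) (auto intro: continuous_intros)
    note [measurable] = this
    show ?thesis unfolding f_def by measurable
  qed
  have "integrable lborel F"
    unfolding F[abs_def] by (rule integrable_summand[OF f f_meas])
  moreover have int_G: "set_integrable lborel {0..1} G"
    unfolding G[abs_def] by (rule set_integrable_bisum[OF f f_meas])
  moreover have int_K: "set_integrable lborel {0..1} K"
  proof -
    have "moderate (\<lambda>z. 1 + z\<^sup>2)" by auto
    then have "set_integrable lborel {0..1} (\<lambda>x. \<mu> (spiral x) * spiral_gauss x)"
      unfolding \<mu>_def by (rule set_integrable_bisum) measurable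
    then have "set_integrable lborel {0..1} (\<lambda>x. inverse I * (I * K x))"
      unfolding K by (rule set_integrable_mult_right)
    then show ?thesis using I by (simp flip: mult.assoc)
  qed
  moreover have "(LBINT x. F x) = (LBINT x:{0..1}. G x)"
    unfolding F G by (rule integral_summand[OF f f_meas])
  moreover have "(LBINT x:{0..1}. G x) = I * (h * \<delta>) * (LBINT x:{0..1}. K x)"
  proof -
    have "(LBINT x:{0..1}. G x) = (LBINT x:{0..1}. (\<delta> * h * I) * K x)"
      unfolding G' K by (simp only: mult.assoc)
    then show ?thesis by (simp add: mult_ac)
  qed
  moreover have "I * (h * \<delta>) * (LBINT x:{0..1}. K x) =
      of_real (sqrt (2 * pi)) * \<alpha> * exp (2 * (Ln \<alpha>)\<^sup>2 / (- Ln q)) / (q powr (1 / 8) * csqrt (- Ln q)) * h * \<delta>"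
  proof -
    have "I * (LBINT x:{0..1}. K x) = (LBINT x:{0..1}. I * K x)" by simp
    also have "\<dots> = 2 * (LBINT x. spiral_gauss x)"
      using integral_theta unfolding \<mu>_def[symmetric] K .
    also have "\<dots> = of_real (sqrt (2 * pi)) * \<alpha> * exp (2 * (Ln \<alpha>)\<^sup>2 / (- Ln q)) / (q powr (1 / 8) * csqrt (- Ln q))"
    proof -
      have "sqrt 2 * sqrt 2 = 2" by simp
      then have two: "2 = complex_of_real (sqrt 2) * of_real (sqrt 2)"
        by (simp only: of_real_mult[symmetric] of_real_numeral)
      have "s * s * (p / (s * c) * (E / Q)) = s * p * E / (Q * c)" if "s \<noteq> 0" for s p c E Q :: complex
        using that by (simp add: mult_ac)
      from this[of "of_real (sqrt 2)"] show ?thesis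
        unfolding integral_spiral_gauss by (subst two) (simp add: real_sqrt_mult mult_ac)
    qed
    finally show ?thesis by (simp only: mult_ac) (metis mult.left_commute mult.commute)
  qed
  moreover have "Psi_term m n \<beta> a q summable_on UNIV" if "\<beta> \<noteq> 0" for \<beta>
  proof -
    have "Psi_term m n \<beta> a q = summand f a \<beta>"
      unfolding f_def[abs_def] by (rule ext) (rule Psi_term_eq[OF that a])
    then show ?thesis using summable_summand[OF f that, of a] by simp
  qed
  moreover have "Psi m n \<alpha> a q = qpoch_inf [q, - (\<alpha>\<^sup>2), - q / \<alpha>\<^sup>2] q * h * \<delta>"
    using Psi[OF \<alpha>_nonzero] bisum_0_eq_theta[OF \<alpha>_nonzero] by (simp add: \<mu>_def mult_ac)
  moreover have "q powi (- int (n choose 2)) * qpoch [q] q n * \<delta> / q ^ n = h * \<delta>"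
    by (simp add: h_def)
  ultimately show ?thesis
    unfolding Let_def F_def[symmetric] G_def[symmetric] K_def[symmetric] \<delta>_def[symmetric] h_def[symmetric] I_def[symmetric]
    by (intro conjI allI impI) simp_all
qed

end
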